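(* Fix $0<r<1$ and let $T$ be the operator $Tf=f\circ\theta$ induced by an irrational rotation $\theta$ of the circle $\mathbb T$. Then $$H^r(\mathbb T)=\mathcal C\oplus\overline{(I-T)H^r(\mathbb T)},$$ where $\mathcal C$ is the subspace of constant functions and the closure is taken in the $L^r$ metric.
   Context: $\mathbb T$ is the unit circle with normalized Lebesgue measure; an irrational rotation is $\theta(e^{it})=e^{i(t+2\pi\alpha)}$ with $\alpha$ irrational. For $0<r<1$, $L^r(\mathbb T)=\{f:\int|f|^r<\infty\}$ with the complete metric $d(f,g)=\frac1{2\pi}\int_0^{2\pi}|f(e^{it})-g(e^{it})|^r dt$ (the $L^r$ metric). $H^r(\mathbb D)$ is the space of holomorphic functions $f$ on the open unit disc $\mathbb D$ with $\sup_{R<1}\frac1{2\pi}\int_0^{2\pi}|f(Re^{it})|^r dt<\infty$; each such $f$ has radial limits $f(e^{it})=\lim_{R\to1^-}f(Re^{it})$ for a.e. $t$, and $H^r(\mathbb T)\subset L^r(\mathbb T)$ denotes the set of all these boundary functions. It is a closed $T$-invariant subspace of $L^r(\mathbb T)$, and equals the $L^r$-closure of the analytic trigonometric polynomials. $(I-T)H^r(\mathbb T)=\{g-Tg:g\in H^r(\mathbb T)\}$. The symbol $\oplus$ means that the sum is the whole space and the two subspaces intersect only in $0$. *)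

theory Defs
  imports "HOL-Complex_Analysis.Complex_Analysis"
begin

text \<open>
  Elements of \<open>L\<^sup>r\<close> are represented by measurable functions on the circle, and equality of
  elements is equality almost everywhere. All subspaces below are saturated, i.e. they contain
  every measurable function that agrees a.e. with one of their members. The values of a
  function off the unit circle play no role.
\<close>

text \<open>Normalized Lebesgue measure on the unit circle, as the image of the uniform
  distribution on the parameter interval; see \<open>integral_circle\<close>.\<close>

definition circle :: "complex measure" where
  "circle = distr (uniform_measure lborel {0..2 * pi}) (restrict_space borel (sphere 0 1)) cis"

lemma space_circle [simp]: "space circle = sphere 0 1"
  by (simp add: circle_def space_restrict_space)

lemma measurable_cis_circle:
  "cis \<in> measurable (uniform_measure lborel {0..2 * pi}) (restrict_space borel (sphere 0 1))"
proof -
  have "cis \<in> borel_measurable (borel :: real measure)"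
    by (intro borel_measurable_continuous_onI continuous_intros)
  then show ?thesis
    by (auto intro!: measurable_restrict_space2 simp: measurable_lborel1)
qed

lemma integral_circle:
  fixes f :: "complex \<Rightarrow> real"
  assumes "f \<in> borel_measurable circle"
  shows "integral\<^sup>L circle f = 1 / (2 * pi) * (LBINT t:{0..2 * pi}. f (cis t))"
proof -
  have f: "f \<in> borel_measurable (restrict_space borel (sphere 0 1))"
    using assms by (simp add: circle_def)
  have unif: "uniform_measure lborel {0..2 * pi} =
      density lborel (\<lambda>t. ennreal (indicator {0..2 * pi} t / (2 * pi)))"
    unfolding uniform_measure_def
    by (intro density_cong) (auto split: split_indicator simp: divide_ennreal simp flip: ennreal_1)
  have m: "(\<lambda>t. f (cis t)) \<in> borel_measurable lborel"
    using measurable_compose[OF measurable_cis_circle f] by simp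
  have "integral\<^sup>L circle f = (\<integral>t. f (cis t) \<partial>uniform_measure lborel {0..2 * pi})"
    unfolding circle_def by (rule integral_distr[OF measurable_cis_circle f])
  also have "\<dots> = (\<integral>t. indicator {0..2 * pi} t / (2 * pi) * f (cis t) \<partial>lborel)"
    unfolding unif using m by (subst integral_density) (auto split: split_indicator)
  also have "\<dots> = (\<integral>t. 1 / (2 * pi) * (indicator {0..2 * pi} t * f (cis t)) \<partial>lborel)"
    by (intro Bochner_Integration.integral_cong) auto
  also have "\<dots> = 1 / (2 * pi) * (LBINT t:{0..2 * pi}. f (cis t))"
    by (simp add: set_lebesgue_integral_def)
  finally show ?thesis .
qed

definition Lr_space :: "real \<Rightarrow> (complex \<Rightarrow> complex) set" where
  "Lr_space r = {f \<in> borel_measurable circle. integrable circle (\<lambda>z. norm (f z) powr r)}"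

definition Lr_dist :: "real \<Rightarrow> (complex \<Rightarrow> complex) \<Rightarrow> (complex \<Rightarrow> complex) \<Rightarrow> real" where
  "Lr_dist r f g = (\<integral>z. norm (f z - g z) powr r \<partial>circle)"

definition Lr_closure :: "real \<Rightarrow> (complex \<Rightarrow> complex) set \<Rightarrow> (complex \<Rightarrow> complex) set" where
  "Lr_closure r A = {f \<in> Lr_space r. \<forall>\<epsilon>>0. \<exists>g\<in>A. Lr_dist r f g < \<epsilon>}"

definition Hr_disc :: "real \<Rightarrow> (complex \<Rightarrow> complex) set" where
  "Hr_disc r = {F. F holomorphic_on ball 0 1 \<and>
     bdd_above ((\<lambda>R. \<integral>z. norm (F (of_real R * z)) powr r \<partial>circle) ` {0..<1})}"

definition Hr_circle :: "real \<Rightarrow> (complex \<Rightarrow> complex) set" where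
  "Hr_circle r = {f \<in> borel_measurable circle. \<exists>F\<in>Hr_disc r.
     AE z in circle. ((\<lambda>R. F (of_real R * z)) \<longlongrightarrow> f z) (at_left 1)}"

definition constants :: "(complex \<Rightarrow> complex) set" where
  "constants = {f \<in> borel_measurable circle. \<exists>c. AE z in circle. f z = c}"

definition rotation :: "real \<Rightarrow> complex \<Rightarrow> complex" where
  "rotation \<alpha> z = cis (2 * pi * \<alpha>) * z"

definition rot_op :: "real \<Rightarrow> (complex \<Rightarrow> complex) \<Rightarrow> complex \<Rightarrow> complex" where
  "rot_op \<alpha> f = f \<circ> rotation \<alpha>"

definition I_minus_T_image :: "real \<Rightarrow> (complex \<Rightarrow> complex) set \<Rightarrow> (complex \<Rightarrow> complex) set" where
  "I_minus_T_image \<alpha> A = {f \<in> borel_measurable circle.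
     \<exists>g\<in>A. AE z in circle. f z = g z - rot_op \<alpha> g z}"

text \<open>As functions stand for their a.e. classes, sums are taken up to a.e. equality and the
  zero subspace consists of all functions vanishing a.e.\<close>

definition is_direct_sum ::
  "(complex \<Rightarrow> complex) set \<Rightarrow> (complex \<Rightarrow> complex) set \<Rightarrow> (complex \<Rightarrow> complex) set \<Rightarrow> bool" where
  "is_direct_sum H A B \<longleftrightarrow>
     H = {f \<in> borel_measurable circle. \<exists>a\<in>A. \<exists>b\<in>B. AE z in circle. f z = a z + b z} \<and>
     A \<inter> B = {f \<in> borel_measurable circle. AE z in circle. f z = 0}"

end

theory Submission imports Defs begin

text \<open>
  Put \<open>\<omega> = e\<^bsup>2\<pi>i\<alpha>\<^esup>\<close>. On polynomials in \<open>z\<close> the decomposition is algebra: since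
  \<open>\<omega>\<^sup>k \<noteq> 1\<close> for \<open>k > 0\<close>, every polynomial without constant term is \<open>q - q \<circ> \<theta>\<close> for the polynomial
  \<open>q\<close> obtained by dividing the \<open>k\<close>-th coefficient by \<open>1 - \<omega>\<^sup>k\<close>. To pass to \<open>H\<^sup>r\<close> with boundary
  function \<open>f\<close> and holomorphic extension \<open>F\<close>, three facts are used.
  
  \<^item> Polynomials \<open>p\<close> with \<open>p(0) = F(0)\<close> approximate \<open>f\<close> in \<open>L\<^sup>r\<close>
    (\<open>Hr_circle_polynomial_dense\<close>). Hence \<open>f - F(0)\<close> lies in the closure of \<open>(I - T)H\<^sup>r\<close>.
  \<^item> The functional \<open>F(0)\<close> is continuous on \<open>H\<^sup>r\<close> (\<open>point_evaluation_bound\<close>). It vanishes on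
    \<open>(I - T)H\<^sup>r\<close>, so a constant in the closure is \<open>0\<close> and the sum is direct.
  \<^item> \<open>H\<^sup>r\<close> is closed in \<open>L\<^sup>r\<close> (\<open>Hr_circle_closed\<close>), so the closure of \<open>(I - T)H\<^sup>r\<close> stays
    inside \<open>H\<^sup>r\<close>.
  
  For \<open>r < 1\<close> a boundary function need not be integrable, so \<open>F\<close> cannot be recovered from \<open>f\<close> by a
  Poisson integral. The first and the last fact rest instead on the maximal inequality
  \<open>\<integral> sup\<^bsub>0 \<le> a < 1\<^esub> |F(az)|\<^sup>r \<le> 256 \<integral> |f|\<^sup>r\<close> (\<open>nn_integral_hardy_max_le_boundary\<close>): it gives a majorant
  for dominated convergence of the dilates \<open>F(Rz)\<close> to \<open>f\<close>, and it makes radial limits stable under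
  \<open>L\<^sup>r\<close> limits.
  
  The maximal inequality has two ingredients. The function \<open>|F|\<^sup>s\<close> is bounded by its Poisson integral
  for every \<open>0 < s \<le> 1\<close> (\<open>norm_powr_le_poisson\<close>), because zeros in the disc can be reflected to the
  outside without changing the modulus on the circle, and \<open>|G|\<^sup>s\<close> is the modulus of the holomorphic
  function \<open>exp (s log G)\<close> when \<open>G\<close> has no zeros. With \<open>s = r/2\<close> it remains to bound the maximal
  Poisson integral on \<open>L\<^sup>2\<close>. Choosing the radius as a measurable function of the point turns it into a
  linear operator \<open>S\<close>. The Poisson kernels at radii \<open>a\<close> and \<open>b\<close> compose to the one at radius \<open>ab\<close>,
  which is at most \<open>8\<close> times the one at the smaller radius. Hence \<open>S S\<^sup>*\<close> is dominated pointwise by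
  \<open>8 (S + S\<^sup>*)\<close>, so \<open>\<parallel>S\<parallel>\<^sup>2 \<le> 16 \<parallel>S\<parallel>\<close>
  (\<open>quasi_selfadjoint_L2_bound\<close>), and \<open>16\<^sup>2 = 256\<close>.
\<close>

section \<open>Integration over the circle and the Poisson formula\<close>

lemma uniform_measure_interval_density:
  "uniform_measure lborel {0..2 * pi} =
      density lborel (\<lambda>t. ennreal (indicator {0..2 * pi} t / (2 * pi)))"
    unfolding uniform_measure_def
    by (intro density_cong) (auto split: split_indicator simp: divide_ennreal simp flip: ennreal_1)

lemma sets_circle: "sets circle = sets (restrict_space borel (sphere 0 1))"
  by (simp add: circle_def)

lemma measurable_cis_circle': "cis \<in> measurable borel circle"
  using measurable_cis_circle by (simp add: circle_def cong: measurable_cong_sets)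

text \<open>
  The half-open interval makes the integrand match periodic shifts exactly.
\<close>

lemma nn_integral_circle:
  assumes "f \<in> borel_measurable circle"
  shows "(\<integral>\<^sup>+z. f z \<partial>circle) =
    (\<integral>\<^sup>+t. ennreal (1 / (2 * pi)) * (indicator {0..<2 * pi} t * f (cis t)) \<partial>lborel)"
proof -
  have f: "f \<in> borel_measurable (restrict_space borel (sphere 0 1))"
    using assms by (simp add: circle_def)
  have m: "(\<lambda>t. f (cis t)) \<in> borel_measurable lborel"
    using measurable_compose[OF measurable_cis_circle' assms] by simp
  have "(\<integral>\<^sup>+z. f z \<partial>circle) = (\<integral>\<^sup>+t. f (cis t) \<partial>uniform_measure lborel {0..2 * pi})"
    unfolding circle_def by (rule nn_integral_distr[OF measurable_cis_circle]) (simp add: f)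
  also have "\<dots> = (\<integral>\<^sup>+t. ennreal (indicator {0..2 * pi} t / (2 * pi)) * f (cis t) \<partial>lborel)"
    unfolding uniform_measure_interval_density using m by (subst nn_integral_density) auto
  also have "\<dots> = (\<integral>\<^sup>+t. ennreal (1 / (2 * pi)) * (indicator {0..<2 * pi} t * f (cis t)) \<partial>lborel)"
    by (rule nn_integral_cong_AE, rule AE_mp[OF AE_lborel_singleton[of "2*pi"]])
      (auto split: split_indicator)
  finally show ?thesis .
qed

lemma emeasure_circle: "emeasure circle (sphere 0 1) = 1"
proof -
  have "emeasure circle (sphere 0 1) = (\<integral>\<^sup>+z. 1 \<partial>circle)"
    by (simp flip: space_circle)
  also have "\<dots> = ennreal (1 / (2 * pi)) * ennreal (2 * pi)"
    by (subst nn_integral_circle) (auto simp: nn_integral_cmult)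
  also have "\<dots> = 1"
    by (simp flip: ennreal_mult')
  finally show ?thesis .
qed

interpretation circle: finite_measure circle
  by standard (simp add: emeasure_circle)

lemma measure_circle: "measure circle (sphere 0 1) = 1"
  using emeasure_circle by (simp add: measure_def)

text \<open>
  The part of the shifted period that leaves \<open>[0, p)\<close> on the right re-enters on the left.
\<close>

lemma nn_integral_periodic_shift:
  fixes g :: "real \<Rightarrow> ennreal"
  assumes [measurable]: "g \<in> borel_measurable borel" and per: "\<And>t. g (t + p) = g t"
    and a: "0 \<le> a" "a \<le> p"
  shows "(\<integral>\<^sup>+t. indicator {0..<p} t * g (t + a) \<partial>lborel) = (\<integral>\<^sup>+t. indicator {0..<p} t * g t \<partial>lborel)"
proof -
  have "(\<integral>\<^sup>+t. indicator {0..<p} t * g (t + a) \<partial>lborel)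
      = (\<integral>\<^sup>+t. indicator {a..<p} t * g t + indicator {p..<p+a} t * g t \<partial>lborel)"
    using a by (subst (2) nn_integral_real_affine[where c = 1 and t = a])
      (auto intro!: nn_integral_cong split: split_indicator simp: add.commute)
  also have "\<dots> = (\<integral>\<^sup>+t. indicator {a..<p} t * g t \<partial>lborel) + (\<integral>\<^sup>+t. indicator {p..<p+a} t * g t \<partial>lborel)"
    by (rule nn_integral_add) auto
  also have "(\<integral>\<^sup>+t. indicator {p..<p+a} t * g t \<partial>lborel) = (\<integral>\<^sup>+t. indicator {0..<a} t * g t \<partial>lborel)"
    using a by (subst nn_integral_real_affine[where c = 1 and t = p])
      (auto intro!: nn_integral_cong split: split_indicator simp: add.commute per)
  also have "(\<integral>\<^sup>+t. indicator {a..<p} t * g t \<partial>lborel) + (\<integral>\<^sup>+t. indicator {0..<a} t * g t \<partial>lborel)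
      = (\<integral>\<^sup>+t. indicator {a..<p} t * g t + indicator {0..<a} t * g t \<partial>lborel)"
    by (rule nn_integral_add[symmetric]) auto
  also have "\<dots> = (\<integral>\<^sup>+t. indicator {0..<p} t * g t \<partial>lborel)"
    using a by (auto intro!: nn_integral_cong split: split_indicator)
  finally show ?thesis .
qed

lemma measurable_rotate_circle:
  assumes "norm c = 1"
  shows "(\<lambda>z. c * z) \<in> measurable circle circle"
proof -
  have "(\<lambda>z. c * z) \<in> measurable (restrict_space borel (sphere 0 1)) (restrict_space borel (sphere 0 1))"
    using assms by (intro measurable_restrict_space3) (auto simp: norm_mult)
  then show ?thesis
    by (simp add: sets_circle cong: measurable_cong_sets)
qed

lemma nn_integral_circle_rotate:
  assumes c: "norm c = 1" and f[measurable]: "f \<in> borel_measurable circle"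
  shows "(\<integral>\<^sup>+z. f (c * z) \<partial>circle) = (\<integral>\<^sup>+z. f z \<partial>circle)"
proof -
  have "c = cis (Arg2pi c)"
    using c Arg2pi_eq[of c] by (simp add: cis_conv_exp)
  then obtain a where a: "c = cis a" "0 \<le> a" "a \<le> 2 * pi"
    using Arg2pi_ge_0[of c] Arg2pi_lt_2pi[of c] by (metis less_imp_le)
  have [measurable]: "(\<lambda>z. f (cis a * z)) \<in> borel_measurable circle"
    using measurable_rotate_circle[OF c] unfolding a(1) by measurable
  have [measurable]: "(\<lambda>t. f (cis t)) \<in> borel_measurable borel"
    using measurable_cis_circle' by measurable
  have [measurable]: "(\<lambda>t. f (cis (t + a))) \<in> borel_measurable borel"
    by (rule measurable_compose[of "\<lambda>t. t + a" borel borel "\<lambda>t. f (cis t)"]) measurable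
  have "(\<integral>\<^sup>+z. f (c * z) \<partial>circle) =
     ennreal (1 / (2 * pi)) * (\<integral>\<^sup>+t. indicator {0..<2 * pi} t * f (cis (t + a)) \<partial>lborel)"
    by (subst nn_integral_circle) (auto simp: nn_integral_cmult a(1) cis_mult add.commute)
  also have "(\<integral>\<^sup>+t. indicator {0..<2 * pi} t * f (cis (t + a)) \<partial>lborel) =
     (\<integral>\<^sup>+t. indicator {0..<2 * pi} t * f (cis t) \<partial>lborel)"
    by (rule nn_integral_periodic_shift) (use a in \<open>auto simp flip: cis_mult\<close>)
  also have "ennreal (1 / (2 * pi)) * \<dots> = (\<integral>\<^sup>+z. f z \<partial>circle)"
    by (subst nn_integral_circle) (auto simp: nn_integral_cmult)
  finally show ?thesis .
qed

lemma AE_circle_rotate: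
  assumes c: "norm c = 1" and "AE z in circle. P z"
  shows "AE z in circle. P (c * z)"
proof -
  from assms(2) obtain N where N: "{z \<in> space circle. \<not> P z} \<subseteq> N" "N \<in> null_sets circle"
    by (auto simp: eventually_ae_filter)
  have m: "(\<lambda>z. c * z) -` N \<inter> space circle \<in> sets circle"
    by (rule measurable_sets[OF measurable_rotate_circle[OF c]]) (use N in auto)
  have "emeasure circle ((\<lambda>z. c * z) -` N \<inter> space circle) = (\<integral>\<^sup>+z. indicator N (c * z) \<partial>circle)"
    by (subst nn_integral_indicator[OF m, symmetric], rule nn_integral_cong) (auto split: split_indicator)
  also have "\<dots> = emeasure circle N"
    using N by (subst nn_integral_circle_rotate[OF c]) auto
  finally have "(\<lambda>z. c * z) -` N \<inter> space circle \<in> null_sets circle"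
    using N(2) m by (simp add: null_sets_def)
  moreover have "{z \<in> space circle. \<not> P (c * z)} \<subseteq> (\<lambda>z. c * z) -` N \<inter> space circle"
    using N(1) c by (auto simp: norm_mult subset_iff)
  ultimately show ?thesis
    by (rule AE_I')
qed

lemma borel_measurable_circle_continuous:
  assumes "continuous_on (sphere 0 1) f"
  shows "f \<in> borel_measurable circle"
  using borel_measurable_continuous_on_restrict[OF assms] by (simp add: circle_def)

lemma integrable_circle_continuous:
  fixes f :: "complex \<Rightarrow> 'a::{banach, second_countable_topology}"
  assumes "continuous_on (sphere 0 1) f"
  shows "integrable circle f"
proof -
  have "compact (f ` sphere 0 1)"
    by (rule compact_continuous_image[OF assms]) auto
  then obtain B where "\<forall>x\<in>sphere 0 1. norm (f x) \<le> B"
    using compact_imp_bounded bounded_iff by (metis imageI)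
  then show ?thesis
    by (intro circle.integrable_const_bound[where B = B] AE_I2
        borel_measurable_circle_continuous[OF assms]) auto
qed

text \<open>
  On the unit circle \<open>dz = i z dt\<close>; this transfers Cauchy's formula to the normalized measure.
\<close>

lemma integral_circle_of_contour_integral:
  assumes f: "continuous_on (sphere 0 1) f"
    and I: "((\<lambda>u. f u / u) has_contour_integral (2 * of_real pi * \<i> * I)) (circlepath 0 1)"
  shows "(\<integral>z. f z \<partial>circle) = I"
proof -
  have "((\<lambda>t. f (cis t) * \<i>) has_integral 2 * of_real pi * \<i> * I) {0..2*pi}"
    using I by (simp add: circlepath_def has_contour_integral_part_circlepath_iff)
  then have "((\<lambda>t. (1 / (2 * of_real pi * \<i>)) * (f (cis t) * \<i>)) has_integral (1 / (2 * of_real pi * \<i>)) * (2 * of_real pi * \<i> * I)) {0..2*pi}"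
    by (rule has_integral_mult_right)
  then have hk: "((\<lambda>t. f (cis t) / (2 * of_real pi)) has_integral I) {0..2*pi}"
    by (simp add: field_simps)
  have c: "continuous_on {0..2*pi} (\<lambda>t. f (cis t) / (2 * of_real pi))"
    by (intro continuous_intros continuous_on_compose2[OF f]) auto
  have m: "(\<lambda>t. f (cis t)) \<in> borel_measurable lborel"
    using measurable_compose[OF measurable_cis_circle' borel_measurable_circle_continuous[OF f]] by simp
  have "(\<integral>z. f z \<partial>circle) = (\<integral>t. f (cis t) \<partial>uniform_measure lborel {0..2 * pi})"
    unfolding circle_def
    by (rule integral_distr[OF measurable_cis_circle])
      (use borel_measurable_circle_continuous[OF f] in \<open>simp add: circle_def\<close>)
  also have "\<dots> = (\<integral>t. (indicator {0..2 * pi} t / (2 * pi)) *\<^sub>R f (cis t) \<partial>lborel)"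
    unfolding uniform_measure_interval_density using m
    by (subst integral_density) (auto split: split_indicator)
  also have "\<dots> = (LBINT t:{0..2*pi}. f (cis t) / (2 * of_real pi))"
    unfolding set_lebesgue_integral_def
    by (intro Bochner_Integration.integral_cong) (auto simp: scaleR_conv_of_real split: split_indicator)
  also have "\<dots> = integral {0..2*pi} (\<lambda>t. f (cis t) / (2 * of_real pi))"
    by (rule set_borel_integral_eq_integral(2)[OF borel_integrable_atLeastAtMost'[OF c]])
  also have "\<dots> = I"
    using hk by (rule integral_unique)
  finally show ?thesis .
qed

definition poisson :: "complex \<Rightarrow> complex \<Rightarrow> real" where
  "poisson \<zeta> w = (1 - (norm \<zeta>)\<^sup>2) / (norm (w - \<zeta>))\<^sup>2"

lemma poisson_nonneg: "norm \<zeta> \<le> 1 \<Longrightarrow> 0 \<le> poisson \<zeta> w"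
  by (simp add: poisson_def power_le_one)

lemma poisson_le:
  assumes "norm \<zeta> < 1" "norm w = 1"
  shows "poisson \<zeta> w \<le> 2 / (1 - norm \<zeta>)"
proof -
  have "1 - norm \<zeta> \<le> norm (w - \<zeta>)"
    using norm_triangle_ineq2[of w \<zeta>] assms by simp
  then have "poisson \<zeta> w \<le> (1 - (norm \<zeta>)\<^sup>2) / (1 - norm \<zeta>)\<^sup>2"
    unfolding poisson_def using assms
    by (intro divide_left_mono mult_pos_pos zero_less_power) (auto simp: power_mono power_le_one)
  also have "\<dots> = (1 + norm \<zeta>) / (1 - norm \<zeta>)"
    using assms by (auto simp: power2_eq_square divide_simps) (simp add: algebra_simps)
  also have "\<dots> \<le> 2 / (1 - norm \<zeta>)"
    using assms by (intro divide_right_mono) auto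
  finally show ?thesis .
qed

lemma continuous_on_poisson:
  "norm \<zeta> < 1 \<Longrightarrow> continuous_on (sphere 0 1) (poisson \<zeta>)"
  unfolding poisson_def by (intro continuous_intros) auto

text \<open>
  Cauchy's formula for \<open>w \<mapsto> f(w) (1 - |\<zeta>|\<^sup>2) / (1 - \<zeta>\<^sup>* w)\<close>, where \<open>\<zeta>\<^sup>*\<close> is the conjugate of \<open>\<zeta>\<close>: the
  factor takes the value \<open>1\<close> at \<open>\<zeta>\<close>, and on the circle it turns the Cauchy kernel into the Poisson
  kernel.
\<close>

theorem poisson_formula:
  assumes cont: "continuous_on (cball 0 1) f" and hol: "f holomorphic_on ball 0 1"
    and z: "norm \<zeta> < 1"
  shows "(\<integral>w. of_real (poisson \<zeta> w) * f w \<partial>circle) = f \<zeta>"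
proof (rule integral_circle_of_contour_integral)
  show "continuous_on (sphere 0 1) (\<lambda>w. of_real (poisson \<zeta> w) * f w)"
    by (intro continuous_intros continuous_on_poisson z continuous_on_subset[OF cont]) auto
  have nz: "1 - cnj \<zeta> * w \<noteq> 0" if "norm w \<le> 1" for w
  proof
    assume "1 - cnj \<zeta> * w = 0"
    then have "norm (cnj \<zeta> * w) = 1" by simp
    moreover have "norm (cnj \<zeta> * w) \<le> norm \<zeta> * 1"
      unfolding norm_mult using that by (intro mult_mono) auto
    ultimately show False using z by simp
  qed
  define h where "h w = of_real (1 - (norm \<zeta>)\<^sup>2) * f w / (1 - cnj \<zeta> * w)" for w
  have "((\<lambda>u. h u / (u - \<zeta>)) has_contour_integral (2 * of_real pi * \<i> * h \<zeta>)) (circlepath 0 1)"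
    unfolding h_def
    by (rule Cauchy_integral_circlepath) (use nz z in \<open>auto intro!: continuous_intros holomorphic_intros cont hol\<close>)
  moreover have "1 - cnj \<zeta> * \<zeta> = of_real (1 - (norm \<zeta>)\<^sup>2)"
    using complex_norm_square[of \<zeta>] by (simp add: mult.commute)
  then have "h \<zeta> = f \<zeta>"
    using nz[of \<zeta>] z unfolding h_def by auto
  ultimately have "((\<lambda>u. h u / (u - \<zeta>)) has_contour_integral (2 * of_real pi * \<i> * f \<zeta>)) (circlepath 0 1)"
    by simp
  then show "((\<lambda>u. of_real (poisson \<zeta> u) * f u / u) has_contour_integral 2 * of_real pi * \<i> * f \<zeta>) (circlepath 0 1)"
  proof (rule has_contour_integral_eq)
    fix u assume "u \<in> path_image (circlepath 0 1)"
    then have u: "norm u = 1" by (simp add: path_image_circlepath)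
    then have uu: "u * cnj u = 1" "u \<noteq> 0" by (auto simp: complex_norm_square[symmetric])
    have "u * (cnj u - cnj \<zeta>) = 1 - cnj \<zeta> * u"
      using uu by (simp add: algebra_simps)
    then have "(1 - cnj \<zeta> * u) * (u - \<zeta>) = u * of_real ((norm (u - \<zeta>))\<^sup>2)"
      using complex_norm_square[of "u - \<zeta>"] by (simp add: mult_ac)
    then show "h u / (u - \<zeta>) = of_real (poisson \<zeta> u) * f u / u"
      by (simp add: h_def poisson_def field_simps)
  qed
qed

section \<open>Powers of the modulus of a holomorphic function\<close>

text \<open>
  For \<open>t \<le> 1\<close> one has \<open>t \<le> t\<^sup>s\<close>; apply this to \<open>x / (x + y)\<close> and \<open>y / (x + y)\<close>, whose sum is \<open>1\<close>.
\<close>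

lemma powr_add_le:
  fixes x y :: real
  assumes "0 \<le> x" "0 \<le> y" "0 < s" "s \<le> 1"
  shows "(x + y) powr s \<le> x powr s + y powr s"
proof (cases "x + y = 0")
  case True
  then show ?thesis using assms by simp
next
  case False
  then have pos: "x + y > 0" using assms by linarith
  have le: "t / (x + y) \<le> (t / (x + y)) powr s" if "0 \<le> t" "t \<le> x + y" for t
    using powr_mono'[of s 1 "t / (x + y)"] that assms pos by (simp add: field_simps)
  have "1 = x / (x + y) + y / (x + y)"
    using pos by (simp flip: add_divide_distrib)
  also have "\<dots> \<le> (x / (x + y)) powr s + (y / (x + y)) powr s"
    using assms by (intro add_mono le) auto
  also have "\<dots> = (x powr s + y powr s) / (x + y) powr s"
    using assms pos by (simp add: powr_divide add_divide_distrib)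
  finally show ?thesis
    using pos by (simp add: field_simps)
qed

lemma norm_add_powr_le:
  fixes x y :: "'a::real_normed_vector"
  assumes "0 < s" "s \<le> 1"
  shows "norm (x + y) powr s \<le> norm x powr s + norm y powr s"
  using powr_mono2[OF _ _ norm_triangle_ineq[of x y], of s] powr_add_le[of "norm x" "norm y" s] assms
  by simp

lemma norm_diff_powr_le:
  fixes x y :: "'a::real_normed_vector"
  assumes "0 < s" "s \<le> 1"
  shows "norm (x - y) powr s \<le> norm x powr s + norm y powr s"
  using norm_add_powr_le[OF assms, of x "- y"] by simp

lemma tendsto_norm_powr:
  assumes "(f \<longlongrightarrow> l) F" "0 < s"
  shows "((\<lambda>x. norm (f x) powr s) \<longlongrightarrow> norm l powr s) F"
  using assms by (intro tendsto_powr' tendsto_norm tendsto_const) auto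

lemma continuous_on_norm_powr:
  assumes "continuous_on S f" "0 < s"
  shows "continuous_on S (\<lambda>x. norm (f x) powr s)"
  using assms by (intro continuous_on_powr' continuous_intros) auto

lemma blaschke_identity:
  fixes a z :: complex
  shows "(norm (1 - cnj a * z))\<^sup>2 - (norm (z - a))\<^sup>2 = (1 - (norm a)\<^sup>2) * (1 - (norm z)\<^sup>2)"
  unfolding cmod_power2 by (simp add: power2_eq_square algebra_simps)

text \<open>
  Each root \<open>a\<close> in the open disc is replaced by its mirror image in the circle, that is, the factor
  \<open>z - a\<close> by \<open>1 - a\<^sup>* z\<close> with \<open>a\<^sup>*\<close> the conjugate. The quotient of the two is a Blaschke factor, which
  has modulus at most \<open>1\<close> in the disc and equal to \<open>1\<close> on the circle.
\<close>

lemma poly_reflect_zeros: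
  fixes p :: "complex poly"
  assumes "p \<noteq> 0"
  obtains q where "\<And>z. norm z < 1 \<Longrightarrow> poly q z \<noteq> 0"
    "\<And>z. norm z \<le> 1 \<Longrightarrow> norm (poly p z) \<le> norm (poly q z)"
    "\<And>z. norm z = 1 \<Longrightarrow> norm (poly p z) = norm (poly q z)"
proof -
  have "\<exists>q. (\<forall>z. norm z < 1 \<longrightarrow> poly q z \<noteq> 0) \<and>
    (\<forall>z. norm z \<le> 1 \<longrightarrow> norm (poly p z) \<le> norm (poly q z)) \<and>
    (\<forall>z. norm z = 1 \<longrightarrow> norm (poly p z) = norm (poly q z))"
    using assms
  proof (induction "degree p" arbitrary: p rule: less_induct)
    case (less p)
    show ?case
    proof (cases "degree p = 0")
      case True
      then obtain c where "p = [:c:]" by (meson degree_eq_zeroE)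
      with less.prems show ?thesis by (intro exI[of _ p]) auto
    next
      case False
      then have "\<exists>i\<in>{1..degree p}. coeff p i \<noteq> 0"
        using less.prems by (intro bexI[of _ "degree p"]) auto
      then obtain a where "poly p a = 0"
        unfolding poly_altdef using fundamental_theorem_of_algebra by blast
      then obtain p' where p: "p = [:- a, 1:] * p'"
        by (metis dvdE poly_eq_0_iff_dvd)
      have p'0: "p' \<noteq> 0" using p less.prems by auto
      then have "degree p' < degree p" unfolding p by (subst degree_mult_eq) auto
      from less.hyps[OF this p'0] obtain q where
        q1: "\<And>z. norm z < 1 \<Longrightarrow> poly q z \<noteq> 0"
        and q2: "\<And>z. norm z \<le> 1 \<Longrightarrow> norm (poly p' z) \<le> norm (poly q z)"
        and q3: "\<And>z. norm z = 1 \<Longrightarrow> norm (poly p' z) = norm (poly q z)"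
        by blast
      show ?thesis
      proof (cases "norm a < 1")
        case False
        then show ?thesis using q1 q2 q3
          by (intro exI[of _ "[:- a, 1:] * q"]) (auto simp: p norm_mult simp del: mult_pCons_left intro!: mult_left_mono)
      next
        case True
        have "norm (z - a) \<le> norm (1 - cnj a * z)" if "norm z \<le> 1" for z
        proof -
          have "0 \<le> (1 - (norm a)\<^sup>2) * (1 - (norm z)\<^sup>2)"
            using True that by (intro mult_nonneg_nonneg) (auto simp: power_le_one)
          then have "(norm (z - a))\<^sup>2 \<le> (norm (1 - cnj a * z))\<^sup>2"
            unfolding blaschke_identity[symmetric] by simp
          then show ?thesis by (rule power2_le_imp_le) simp
        qed
        moreover have "norm (z - a) = norm (1 - cnj a * z)" if "norm z = 1" for z
          using blaschke_identity[of a z] that by simp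
        moreover have "1 - cnj a * z \<noteq> 0" if "norm z < 1" for z
        proof
          assume "1 - cnj a * z = 0"
          then have "norm (cnj a * z) = 1" by simp
          moreover have "norm (cnj a * z) \<le> norm a * 1"
            unfolding norm_mult using that by (intro mult_mono) auto
          ultimately show False using True by simp
        qed
        ultimately show ?thesis using q1 q2 q3
          by (intro exI[of _ "[:1, - cnj a:] * q"])
            (auto simp: p norm_mult mult.commute[of _ "cnj a"] simp del: mult_pCons_left intro!: mult_mono)
      qed
    qed
  qed
  then show thesis using that by blast
qed

text \<open>
  A zero-free \<open>g\<close> has a logarithm \<open>h\<close>, and \<open>|g|\<^sup>s\<close> is the modulus of the holomorphic function
  \<open>exp (s h)\<close>, to which the Poisson formula applies.
\<close>

lemma norm_powr_le_poisson_nonvanishing: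
  assumes hol: "g holomorphic_on ball 0 R" and R: "R > 1"
    and nz: "\<And>z. z \<in> ball 0 R \<Longrightarrow> g z \<noteq> 0" and z: "norm \<zeta> < 1"
  shows "norm (g \<zeta>) powr s \<le> (\<integral>w. poisson \<zeta> w * norm (g w) powr s \<partial>circle)"
proof -
  obtain h where h: "h holomorphic_on ball 0 R" "\<And>z. z \<in> ball 0 R \<Longrightarrow> g z = exp (h z)"
    using contractible_imp_holomorphic_log[OF hol convex_imp_contractible[OF convex_ball] nz] by blast
  define e where "e w = exp (of_real s * h w)" for w
  have norm_e: "norm (e w) = norm (g w) powr s" if "w \<in> ball 0 R" for w
    using h(2)[OF that] by (simp add: e_def exp_powr_real mult.commute)
  have hole: "e holomorphic_on ball 0 R"
    unfolding e_def by (intro holomorphic_intros h)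
  have sub: "cball 0 1 \<subseteq> ball (0::complex) R" "ball 0 1 \<subseteq> ball (0::complex) R"
    "sphere 0 1 \<subseteq> ball (0::complex) R"
    using R by auto
  have conte: "continuous_on (cball 0 1) e"
    using holomorphic_on_imp_continuous_on[OF holomorphic_on_subset[OF hole sub(1)]] .
  have "norm (g \<zeta>) powr s = norm (e \<zeta>)"
    using norm_e[of \<zeta>] z R by simp
  also have "e \<zeta> = (\<integral>w. of_real (poisson \<zeta> w) * e w \<partial>circle)"
    using poisson_formula[OF conte holomorphic_on_subset[OF hole sub(2)] z] by simp
  also have "norm \<dots> \<le> (\<integral>w. norm (of_real (poisson \<zeta> w) * e w) \<partial>circle)"
    by (rule integral_norm_bound)
  also have "\<dots> = (\<integral>w. poisson \<zeta> w * norm (g w) powr s \<partial>circle)"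
    using sub(3) z by (intro Bochner_Integration.integral_cong refl)
      (auto simp: norm_mult norm_e abs_of_nonneg poisson_nonneg)
  finally show ?thesis .
qed

text \<open>
  Limits at the circle are taken along this fixed sequence, so that the convergence theorems for
  sequences of integrals apply.
\<close>

definition radius :: "nat \<Rightarrow> real" where
  "radius n = 1 - 1 / real (n + 2)"

lemma radius_bounds: "0 < radius n" "radius n < 1"
  by (auto simp: radius_def)

lemma radius_tendsto: "radius \<longlonglongrightarrow> 1"
proof -
  have "(\<lambda>n. inverse (real (Suc (Suc n)))) \<longlonglongrightarrow> 0"
    using LIMSEQ_inverse_real_of_nat by (rule LIMSEQ_Suc)
  then have "(\<lambda>n. 1 - inverse (real (Suc (Suc n)))) \<longlonglongrightarrow> 1 - 0"
    by (intro tendsto_diff tendsto_const)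
  then show ?thesis
    by (simp add: radius_def[abs_def] divide_inverse add.commute)
qed

lemma norm_powr_le_poisson_poly:
  fixes p :: "complex poly"
  assumes z: "norm \<zeta> < 1" and s: "0 < s"
  shows "norm (poly p \<zeta>) powr s \<le> (\<integral>w. poisson \<zeta> w * norm (poly p w) powr s \<partial>circle)"
proof (cases "p = 0")
  case True
  then show ?thesis by simp
next
  case False
  then obtain q where q: "\<And>z. norm z < 1 \<Longrightarrow> poly q z \<noteq> 0"
    "\<And>z. norm z \<le> 1 \<Longrightarrow> norm (poly p z) \<le> norm (poly q z)"
    "\<And>z. norm z = 1 \<Longrightarrow> norm (poly p z) = norm (poly q z)"
    using poly_reflect_zeros by blast
  \<comment> \<open>The reflected polynomial may still vanish on the circle, so it is dilated to have no zeros near the closed disc.\<close>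
  have le: "norm (poly q (of_real (radius n) * \<zeta>)) powr s
      \<le> (\<integral>w. poisson \<zeta> w * norm (poly q (of_real (radius n) * w)) powr s \<partial>circle)" for n
  proof (rule norm_powr_le_poisson_nonvanishing[where R = "1 / radius n"])
    fix z :: complex assume "z \<in> ball 0 (1 / radius n)"
    then show "poly q (of_real (radius n) * z) \<noteq> 0"
      using radius_bounds[of n] by (intro q(1)) (auto simp: norm_mult field_simps)
  qed (use radius_bounds[of n] z in \<open>auto intro!: holomorphic_intros\<close>)
  have "compact (poly q ` cball 0 1)"
    by (intro compact_continuous_image continuous_intros) auto
  then obtain B where B: "\<And>z. norm z \<le> 1 \<Longrightarrow> norm (poly q z) \<le> B"
    using compact_imp_bounded bounded_iff by (metis imageI mem_cball_0)
  have lim: "(\<lambda>n. of_real (radius n) * w) \<longlonglongrightarrow> w" for w :: complex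
    using tendsto_mult[OF tendsto_of_real[OF radius_tendsto] tendsto_const[of w]] by simp
  have limq: "(\<lambda>n. norm (poly q (of_real (radius n) * w)) powr s) \<longlonglongrightarrow> norm (poly q w) powr s" for w
    by (intro tendsto_norm_powr s tendsto_poly lim)
  have "(\<lambda>n. \<integral>w. poisson \<zeta> w * norm (poly q (of_real (radius n) * w)) powr s \<partial>circle)
      \<longlonglongrightarrow> (\<integral>w. poisson \<zeta> w * norm (poly q w) powr s \<partial>circle)"
  proof (rule integral_dominated_convergence)
    show "integrable circle (\<lambda>w. poisson \<zeta> w * B powr s)"
      by (intro integrable_circle_continuous continuous_intros continuous_on_poisson z)
    show "AE w in circle. norm (poisson \<zeta> w * norm (poly q (of_real (radius n) * w)) powr s)
        \<le> poisson \<zeta> w * B powr s" for n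
    proof (rule AE_I2)
      fix w assume "w \<in> space circle"
      then have "norm (of_real (radius n) * w) \<le> 1"
        using radius_bounds[of n] by (simp add: norm_mult)
      from B[OF this] show "norm (poisson \<zeta> w * norm (poly q (of_real (radius n) * w)) powr s)
        \<le> poisson \<zeta> w * B powr s"
        using z s by (auto simp: abs_mult poisson_nonneg abs_of_nonneg intro!: mult_left_mono powr_mono2)
    qed
    show "AE w in circle. (\<lambda>n. poisson \<zeta> w * norm (poly q (of_real (radius n) * w)) powr s)
        \<longlonglongrightarrow> poisson \<zeta> w * norm (poly q w) powr s"
      by (intro AE_I2 tendsto_mult tendsto_const limq)
  qed (intro borel_measurable_circle_continuous continuous_intros continuous_on_poisson
      continuous_on_norm_powr z s; simp)+
  then have "norm (poly q \<zeta>) powr s \<le> (\<integral>w. poisson \<zeta> w * norm (poly q w) powr s \<partial>circle)"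
    by (rule LIMSEQ_le[OF limq]) (use le in blast)
  also have "\<dots> = (\<integral>w. poisson \<zeta> w * norm (poly p w) powr s \<partial>circle)"
    by (intro Bochner_Integration.integral_cong) (auto simp: q(3))
  finally show ?thesis
    using powr_mono2[OF _ _ q(2)[of \<zeta>], of s] z s by simp
qed

text \<open>
  The Taylor polynomials; all of them have the value \<open>F 0\<close> at the origin.
\<close>

lemma holomorphic_uniform_limit_polys:
  assumes hol: "F holomorphic_on ball 0 R" and R: "R > 1"
  obtains p :: "nat \<Rightarrow> complex poly"
  where "uniform_limit (cball 0 1) (\<lambda>n. poly (p n)) F sequentially" "\<And>n. poly (p n) 0 = F 0"
proof -
  define c where "c n = (deriv ^^ n) F 0 / fact n" for n
  have sums: "(\<lambda>n. c n * z ^ n) sums F z" if "norm z < R" for z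
    using holomorphic_power_series[OF hol, of z] that by (simp add: c_def)
  obtain \<rho> where \<rho>: "1 < \<rho>" "\<rho> < R" using dense[OF R] by blast
  have "summable (\<lambda>n. norm (c n * 1 ^ n))"
    by (rule powser_insidea[of _ "of_real \<rho>"]) (use \<rho> sums[of "of_real \<rho>"] in \<open>auto simp: sums_iff\<close>)
  then have sc: "summable (\<lambda>n. norm (c n))" by simp
  have "uniform_limit (cball 0 1) (\<lambda>n z. \<Sum>i<n. c i * z ^ i) (\<lambda>z. \<Sum>i. c i * z ^ i) sequentially"
    by (rule Weierstrass_m_test[OF _ sc]) (auto simp: norm_mult norm_power intro!: mult_left_le power_le_one)
  then have "uniform_limit (cball 0 1) (\<lambda>n z. \<Sum>i<Suc n. c i * z ^ i) (\<lambda>z. \<Sum>i. c i * z ^ i) sequentially"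
    using filterlim_compose[OF _ filterlim_Suc] by blast
  moreover have "(\<Sum>i. c i * z ^ i) = F z" if "z \<in> cball 0 1" for z
    using sums[of z] that R by (simp add: sums_iff)
  ultimately have "uniform_limit (cball 0 1) (\<lambda>n. poly (\<Sum>i<Suc n. monom (c i) i)) F sequentially"
    by (subst uniform_limit_cong'[where g = "\<lambda>n z. \<Sum>i<Suc n. c i * z ^ i" and i = "\<lambda>z. \<Sum>i. c i * z ^ i"])
      (auto simp: poly_sum poly_monom)
  moreover have "poly (\<Sum>i<Suc n. monom (c i) i) 0 = F 0" for n
    by (simp add: poly_sum poly_monom c_def sum.lessThan_Suc_shift del: sum.lessThan_Suc)
  ultimately show thesis by (rule that)
qed

text \<open>
  The sub-mean-value property of \<open>|F|\<^sup>s\<close>. It passes from the Taylor polynomials to \<open>F\<close> because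
  \<open>|x + y|\<^sup>s \<le> |x|\<^sup>s + |y|\<^sup>s\<close> for \<open>s \<le> 1\<close>, so that uniform approximation controls the integrals.
\<close>

theorem norm_powr_le_poisson:
  assumes hol: "F holomorphic_on ball 0 R" and R: "R > 1"
    and z: "norm \<zeta> < 1" and s: "0 < s" "s \<le> 1"
  shows "norm (F \<zeta>) powr s \<le> (\<integral>w. poisson \<zeta> w * norm (F w) powr s \<partial>circle)"
proof (rule field_le_epsilon)
  fix e :: real assume e: "e > 0"
  obtain p where p: "uniform_limit (cball 0 1) (\<lambda>n. poly (p n)) F sequentially"
    using holomorphic_uniform_limit_polys[OF hol R] by blast
  define \<epsilon> where "\<epsilon> = (e / 2) powr (1 / s)"
  have \<epsilon>: "\<epsilon> > 0" "\<epsilon> powr s = e / 2"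
    using e s by (auto simp: \<epsilon>_def powr_powr)
  obtain n where n: "\<And>w. w \<in> cball 0 1 \<Longrightarrow> dist (poly (p n) w) (F w) < \<epsilon>"
    using uniform_limitD[OF p \<epsilon>(1)] unfolding eventually_sequentially by (metis order_refl)
  have near: "norm (poly (p n) w - F w) powr s \<le> e / 2" if "w \<in> cball 0 1" for w
    using powr_mono2[of s "norm (poly (p n) w - F w)" \<epsilon>] n[OF that] s \<epsilon> by (simp add: dist_norm)
  have contF: "continuous_on (sphere 0 1) F"
    by (rule holomorphic_on_imp_continuous_on[OF holomorphic_on_subset[OF hol]]) (use R in auto)
  have ip: "integrable circle (\<lambda>w. poisson \<zeta> w * norm (poly (p n) w) powr s)"
    "integrable circle (poisson \<zeta>)"
    "integrable circle (\<lambda>w. poisson \<zeta> w * norm (F w) powr s)"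
    by (intro integrable_circle_continuous continuous_intros continuous_on_poisson
      continuous_on_norm_powr z s contF; simp)+
  have "(\<integral>w. poisson \<zeta> w \<partial>circle) = 1"
  proof -
    have "of_real (\<integral>w. poisson \<zeta> w \<partial>circle) = (\<integral>w. complex_of_real (poisson \<zeta> w) \<partial>circle)"
      by simp
    also have "\<dots> = 1"
      using poisson_formula[of "\<lambda>_. 1" \<zeta>] z by simp
    finally show ?thesis using of_real_eq_1_iff by blast
  qed
  have "norm (F \<zeta>) powr s \<le> norm (poly (p n) \<zeta>) powr s + norm (poly (p n) \<zeta> - F \<zeta>) powr s"
    using norm_diff_powr_le[OF s, of "poly (p n) \<zeta>" "poly (p n) \<zeta> - F \<zeta>"] by simp
  also have "\<dots> \<le> (\<integral>w. poisson \<zeta> w * norm (poly (p n) w) powr s \<partial>circle) + e / 2"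
    by (intro add_mono norm_powr_le_poisson_poly near z s) (use z in auto)
  also have "(\<integral>w. poisson \<zeta> w * norm (poly (p n) w) powr s \<partial>circle)
      \<le> (\<integral>w. poisson \<zeta> w * norm (F w) powr s + poisson \<zeta> w * (e / 2) \<partial>circle)"
  proof (rule integral_mono)
    show "integrable circle (\<lambda>w. poisson \<zeta> w * norm (F w) powr s + poisson \<zeta> w * (e / 2))"
      using ip by simp
    fix w assume "w \<in> space circle"
    then have "norm (poly (p n) w) powr s \<le> norm (F w) powr s + e / 2"
      using norm_add_powr_le[OF s, of "F w" "poly (p n) w - F w"] near[of w] by simp
    then show "poisson \<zeta> w * norm (poly (p n) w) powr s
        \<le> poisson \<zeta> w * norm (F w) powr s + poisson \<zeta> w * (e / 2)"
      using mult_left_mono[OF _ poisson_nonneg[of \<zeta> w]] z unfolding distrib_left[symmetric] by simp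
  qed (rule ip)
  also have "\<dots> = (\<integral>w. poisson \<zeta> w * norm (F w) powr s \<partial>circle) + e / 2"
    using ip \<open>(\<integral>w. poisson \<zeta> w \<partial>circle) = 1\<close> by simp
  finally show "norm (F \<zeta>) powr s \<le> (\<integral>w. poisson \<zeta> w * norm (F w) powr s \<partial>circle) + e"
    by simp
qed

section \<open>The maximal Poisson integral on square integrable functions\<close>

lemma le_if_square_le_sqrt:
  fixes I V E B :: real
  assumes "0 \<le> I" "0 \<le> V" "0 \<le> E" "0 \<le> B" "I\<^sup>2 \<le> V * (2 * B * (sqrt E * I))"
  shows "I \<le> 2 * B * sqrt E * V"
proof (cases "I = 0")
  case False
  then have "I > 0" using assms by simp
  have "I * I \<le> (2 * B * sqrt E * V) * I"
    using assms(5) by (simp add: power2_eq_square mult_ac)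
  then show ?thesis using \<open>I > 0\<close> by (rule mult_right_le_imp_le)
qed (use assms in simp)

text \<open>
  Self-improvement of an operator bound. Let \<open>T\<close> have the kernel \<open>k\<close> and let \<open>N = T v\<close>. Then
  \<open>\<parallel>N\<parallel>\<^sup>2 = \<langle>v, T\<^sup>* N\<rangle> \<le> \<parallel>v\<parallel> \<parallel>T\<^sup>* N\<parallel>\<close>, while the hypothesis on the kernel says that \<open>T T\<^sup>*\<close> is dominated
  by \<open>B (T + T\<^sup>*)\<close>, whence \<open>\<parallel>T\<^sup>* N\<parallel>\<^sup>2 \<le> 2 B \<langle>N, T N\<rangle> \<le> 2 B \<surd>E \<parallel>N\<parallel>\<^sup>2\<close>. So the constant \<open>E\<close> for the
  squared norms improves to \<open>2 B \<surd>E\<close>.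
\<close>

lemma (in finite_measure) quasi_selfadjoint_L2_step:
  fixes k :: "'a \<Rightarrow> 'a \<Rightarrow> ennreal" and B E :: real
  assumes k[measurable]: "(\<lambda>(x, y). k x y) \<in> borel_measurable (M \<Otimes>\<^sub>M M)"
    and comp: "\<And>x x'. x \<in> space M \<Longrightarrow> x' \<in> space M \<Longrightarrow>
      (\<integral>\<^sup>+y. k x y * k x' y \<partial>M) \<le> ennreal B * (k x x' + k x' x)"
    and B: "0 \<le> B" and E: "0 \<le> E"
    and bound: "\<And>v. v \<in> borel_measurable M \<Longrightarrow>
      (\<integral>\<^sup>+x. (\<integral>\<^sup>+y. k x y * v y \<partial>M)\<^sup>2 \<partial>M) \<le> ennreal E * (\<integral>\<^sup>+x. (v x)\<^sup>2 \<partial>M)"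
    and v[measurable]: "v \<in> borel_measurable M" and fin: "(\<integral>\<^sup>+x. (v x)\<^sup>2 \<partial>M) < \<infinity>"
  shows "(\<integral>\<^sup>+x. (\<integral>\<^sup>+y. k x y * v y \<partial>M)\<^sup>2 \<partial>M) \<le> ennreal (2 * B * sqrt E) * (\<integral>\<^sup>+x. (v x)\<^sup>2 \<partial>M)"
proof -
  interpret pair_sigma_finite M M ..
  define T where "T v x = (\<integral>\<^sup>+y. k x y * v y \<partial>M)" for v x
  have T_meas[measurable]: "T v \<in> borel_measurable M" if [measurable]: "v \<in> borel_measurable M" for v
    unfolding T_def by measurable
  define N where "N = T v"
  have N[measurable]: "N \<in> borel_measurable M" unfolding N_def by measurable
  \<comment> \<open>This is the adjoint operator applied to \<open>N\<close>.\<close>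
  define \<Phi> where "\<Phi> y = (\<integral>\<^sup>+x. N x * k x y \<partial>M)" for y
  have [measurable]: "\<Phi> \<in> borel_measurable M" unfolding \<Phi>_def by measurable
  define I where "I = (\<integral>\<^sup>+x. (N x)\<^sup>2 \<partial>M)"
  define V where "V = (\<integral>\<^sup>+x. (v x)\<^sup>2 \<partial>M)"
  define J where "J = (\<integral>\<^sup>+x. N x * T N x \<partial>M)"
  have "I = (\<integral>\<^sup>+x. \<integral>\<^sup>+y. N x * (k x y * v y) \<partial>M \<partial>M)"
    unfolding I_def by (intro nn_integral_cong) (simp add: power2_eq_square nn_integral_cmult, simp add: N_def T_def)
  also have "\<dots> = (\<integral>\<^sup>+y. \<integral>\<^sup>+x. N x * (k x y * v y) \<partial>M \<partial>M)"
    by (rule Fubini') measurable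
  also have "\<dots> = (\<integral>\<^sup>+y. v y * \<Phi> y \<partial>M)"
    unfolding \<Phi>_def by (intro nn_integral_cong) (simp add: nn_integral_cmult[symmetric] mult_ac)
  finally have "I = (\<integral>\<^sup>+y. v y * \<Phi> y \<partial>M)" .
  then have 1: "I\<^sup>2 \<le> V * (\<integral>\<^sup>+y. (\<Phi> y)\<^sup>2 \<partial>M)"
    unfolding V_def by (simp add: Cauchy_Schwarz_nn_integral)
  have "(\<integral>\<^sup>+y. (\<Phi> y)\<^sup>2 \<partial>M) = (\<integral>\<^sup>+y. \<integral>\<^sup>+x. \<integral>\<^sup>+x'. (N x * N x') * (k x y * k x' y) \<partial>M \<partial>M \<partial>M)"
  proof (rule nn_integral_cong)
    fix y assume [measurable]: "y \<in> space M"
    have "(\<Phi> y)\<^sup>2 = (\<integral>\<^sup>+x. N x * k x y * \<Phi> y \<partial>M)"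
      unfolding power2_eq_square by (subst (1) \<Phi>_def) (simp add: nn_integral_multc)
    also have "\<dots> = (\<integral>\<^sup>+x. \<integral>\<^sup>+x'. (N x * N x') * (k x y * k x' y) \<partial>M \<partial>M)"
      unfolding \<Phi>_def by (intro nn_integral_cong) (simp add: nn_integral_cmult[symmetric] mult_ac)
    finally show "(\<Phi> y)\<^sup>2 = \<dots>" .
  qed
  also have "\<dots> = (\<integral>\<^sup>+x. \<integral>\<^sup>+y. \<integral>\<^sup>+x'. (N x * N x') * (k x y * k x' y) \<partial>M \<partial>M \<partial>M)"
    by (rule Fubini') measurable
  also have "\<dots> = (\<integral>\<^sup>+x. \<integral>\<^sup>+x'. \<integral>\<^sup>+y. (N x * N x') * (k x y * k x' y) \<partial>M \<partial>M \<partial>M)"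
    by (intro nn_integral_cong Fubini') measurable
  also have "\<dots> = (\<integral>\<^sup>+x. \<integral>\<^sup>+x'. (N x * N x') * (\<integral>\<^sup>+y. k x y * k x' y \<partial>M) \<partial>M \<partial>M)"
    by (intro nn_integral_cong nn_integral_cmult) measurable
  also have "\<dots> \<le> (\<integral>\<^sup>+x. \<integral>\<^sup>+x'. (N x * N x') * (ennreal B * (k x x' + k x' x)) \<partial>M \<partial>M)"
    by (intro nn_integral_mono mult_left_mono comp) auto
  also have "\<dots> = (\<integral>\<^sup>+x. (\<integral>\<^sup>+x'. ennreal B * (N x * (k x x' * N x')) \<partial>M) +
      (\<integral>\<^sup>+x'. ennreal B * (N x' * (k x' x * N x)) \<partial>M) \<partial>M)"
  proof (rule nn_integral_cong)
    fix x assume [measurable]: "x \<in> space M"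
    have "(\<integral>\<^sup>+x'. (N x * N x') * (ennreal B * (k x x' + k x' x)) \<partial>M) =
      (\<integral>\<^sup>+x'. ennreal B * (N x * (k x x' * N x')) + ennreal B * (N x' * (k x' x * N x)) \<partial>M)"
      by (intro nn_integral_cong) (simp add: distrib_left mult_ac)
    also have "\<dots> = (\<integral>\<^sup>+x'. ennreal B * (N x * (k x x' * N x')) \<partial>M) +
      (\<integral>\<^sup>+x'. ennreal B * (N x' * (k x' x * N x)) \<partial>M)"
      by (rule nn_integral_add) measurable
    finally show "(\<integral>\<^sup>+x'. (N x * N x') * (ennreal B * (k x x' + k x' x)) \<partial>M) = \<dots>" .
  qed
  also have "\<dots> = (\<integral>\<^sup>+x. \<integral>\<^sup>+x'. ennreal B * (N x * (k x x' * N x')) \<partial>M \<partial>M) +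
      (\<integral>\<^sup>+x. \<integral>\<^sup>+x'. ennreal B * (N x' * (k x' x * N x)) \<partial>M \<partial>M)"
    by (rule nn_integral_add) measurable
  also have "(\<integral>\<^sup>+x. \<integral>\<^sup>+x'. ennreal B * (N x' * (k x' x * N x)) \<partial>M \<partial>M) =
      (\<integral>\<^sup>+x'. \<integral>\<^sup>+x. ennreal B * (N x' * (k x' x * N x)) \<partial>M \<partial>M)"
    by (rule Fubini') measurable
  also have "(\<integral>\<^sup>+x. \<integral>\<^sup>+x'. ennreal B * (N x * (k x x' * N x')) \<partial>M \<partial>M) = ennreal B * J"
  proof -
    have "(\<integral>\<^sup>+x'. ennreal B * (N x * (k x x' * N x')) \<partial>M) = ennreal B * (N x * T N x)"
      if [measurable]: "x \<in> space M" for x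
      unfolding T_def by (subst nn_integral_cmult; (subst nn_integral_cmult)?; simp)
    then have "(\<integral>\<^sup>+x. \<integral>\<^sup>+x'. ennreal B * (N x * (k x x' * N x')) \<partial>M \<partial>M) =
        (\<integral>\<^sup>+x. ennreal B * (N x * T N x) \<partial>M)"
      by (rule nn_integral_cong)
    also have "\<dots> = ennreal B * J"
      unfolding J_def by (rule nn_integral_cmult) measurable
    finally show ?thesis .
  qed
  also have "ennreal B * J + ennreal B * J = ennreal (2 * B) * J"
    using B by (simp add: ennreal_mult mult.assoc) (simp add: mult_2)
  finally have 2: "(\<integral>\<^sup>+y. (\<Phi> y)\<^sup>2 \<partial>M) \<le> ennreal (2 * B) * J" .
  have "J\<^sup>2 \<le> I * (\<integral>\<^sup>+x. (T N x)\<^sup>2 \<partial>M)"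
    unfolding J_def I_def by (rule Cauchy_Schwarz_nn_integral) measurable
  also have "(\<integral>\<^sup>+x. (T N x)\<^sup>2 \<partial>M) \<le> ennreal E * I"
    using bound[OF N] unfolding T_def I_def .
  finally have 3: "J\<^sup>2 \<le> I * (ennreal E * I)"
    by (simp add: mult_left_mono)
  have IV: "I \<le> ennreal E * V"
    unfolding I_def V_def N_def T_def by (rule bound) measurable
  obtain V' where V': "V = ennreal V'" "0 \<le> V'"
    using fin unfolding V_def by (cases "\<integral>\<^sup>+x. (v x)\<^sup>2 \<partial>M") auto
  have "I < \<infinity>" using IV by (simp add: V' flip: ennreal_mult'') (metis ennreal_less_top le_less_trans)
  then obtain I' where I': "I = ennreal I'" "0 \<le> I'"
    by (cases I) auto
  have "J\<^sup>2 < \<infinity>"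
    using 3 unfolding I' by (simp add: E I' flip: ennreal_mult) (metis ennreal_less_top le_less_trans)
  then obtain J' where J': "J = ennreal J'" "0 \<le> J'"
    by (cases J) (auto simp: power2_eq_square ennreal_mult_top)
  have "J'\<^sup>2 \<le> E * I'\<^sup>2"
    using 3 unfolding I' J' using E I' J'
    by (simp add: ennreal_power power2_eq_square mult_ac flip: ennreal_mult)
  then have "J' \<le> sqrt (E * I'\<^sup>2)"
    by (rule real_le_rsqrt)
  then have J'_le: "J' \<le> sqrt E * I'"
    using I' by (simp add: real_sqrt_mult)
  have "I\<^sup>2 \<le> V * (ennreal (2 * B) * J)"
    using 1 2 by (meson mult_left_mono order_trans zero_le)
  then have "I'\<^sup>2 \<le> V' * (2 * B * J')"
    unfolding I' J' V' using B I' J' V' by (simp add: ennreal_power flip: ennreal_mult)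
  also have "\<dots> \<le> V' * (2 * B * (sqrt E * I'))"
    using V' B J'_le by (intro mult_left_mono) auto
  finally have "I' \<le> 2 * B * sqrt E * V'"
    by (intro le_if_square_le_sqrt I' V' E B)
  then have "I \<le> ennreal (2 * B * sqrt E) * V"
    unfolding I' V' using B E V' by (simp flip: ennreal_mult)
  then show ?thesis
    unfolding I_def V_def N_def T_def .
qed

text \<open>
  Norm bound from \<open>T T\<^sup>* \<le> B (T + T\<^sup>*)\<close>: the bound \<open>K\<close> on the kernel makes \<open>T\<close> bounded, so there is
  a best constant \<open>e\<close>; by the self-improvement \<open>e \<le> 2 B \<surd>e\<close>, that is \<open>e \<le> 4 B\<^sup>2\<close>.
\<close>

theorem (in finite_measure) quasi_selfadjoint_L2_bound:
  fixes k :: "'a \<Rightarrow> 'a \<Rightarrow> ennreal" and B K :: real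
  assumes k[measurable]: "(\<lambda>(x, y). k x y) \<in> borel_measurable (M \<Otimes>\<^sub>M M)"
    and comp: "\<And>x x'. x \<in> space M \<Longrightarrow> x' \<in> space M \<Longrightarrow>
      (\<integral>\<^sup>+y. k x y * k x' y \<partial>M) \<le> ennreal B * (k x x' + k x' x)"
    and bdd: "\<And>x y. x \<in> space M \<Longrightarrow> y \<in> space M \<Longrightarrow> k x y \<le> ennreal K"
    and B: "0 < B"
    and v[measurable]: "v \<in> borel_measurable M"
  shows "(\<integral>\<^sup>+x. (\<integral>\<^sup>+y. k x y * v y \<partial>M)\<^sup>2 \<partial>M) \<le> ennreal (4 * B\<^sup>2) * (\<integral>\<^sup>+x. (v x)\<^sup>2 \<partial>M)"
proof -
  define S where "S = {E. 0 \<le> E \<and> (\<forall>v\<in>borel_measurable M.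
    (\<integral>\<^sup>+x. (v x)\<^sup>2 \<partial>M) < \<infinity> \<longrightarrow>
    (\<integral>\<^sup>+x. (\<integral>\<^sup>+y. k x y * v y \<partial>M)\<^sup>2 \<partial>M) \<le> ennreal E * (\<integral>\<^sup>+x. (v x)\<^sup>2 \<partial>M))}"
  define m where "m = measure M (space M)"
  have m: "emeasure M (space M) = ennreal m" "0 \<le> m"
    by (auto simp: m_def emeasure_eq_measure)
  \<comment> \<open>Cauchy--Schwarz in the inner integral gives a first, crude constant.\<close>
  have "((max K 0)\<^sup>2 * m) * m \<in> S"
    unfolding S_def
  proof (intro CollectI conjI ballI impI)
    show "0 \<le> ((max K 0)\<^sup>2 * m) * m" using m by simp
    fix v :: "'a \<Rightarrow> ennreal" assume [measurable]: "v \<in> borel_measurable M"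
    have "(\<integral>\<^sup>+x. (\<integral>\<^sup>+y. k x y * v y \<partial>M)\<^sup>2 \<partial>M) \<le>
       (\<integral>\<^sup>+x. ennreal ((max K 0)\<^sup>2 * m) * (\<integral>\<^sup>+x. (v x)\<^sup>2 \<partial>M) \<partial>M)"
    proof (rule nn_integral_mono)
      fix x assume x[measurable]: "x \<in> space M"
      have "(\<integral>\<^sup>+y. (k x y)\<^sup>2 \<partial>M) \<le> (\<integral>\<^sup>+y. ennreal ((max K 0)\<^sup>2) \<partial>M)"
      proof (rule nn_integral_mono)
        fix y assume "y \<in> space M"
        with x have "k x y \<le> ennreal (max K 0)"
          using bdd by (meson ennreal_leI max.cobounded1 order_trans)
        then show "(k x y)\<^sup>2 \<le> ennreal ((max K 0)\<^sup>2)"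
          using power_mono[of "k x y" "ennreal (max K 0)" 2] by (simp add: ennreal_power)
      qed
      also have "\<dots> = ennreal ((max K 0)\<^sup>2 * m)"
        using m by (simp add: ennreal_mult)
      finally have "(\<integral>\<^sup>+y. (k x y)\<^sup>2 \<partial>M) \<le> ennreal ((max K 0)\<^sup>2 * m)" .
      moreover have "(\<integral>\<^sup>+y. k x y * v y \<partial>M)\<^sup>2 \<le> (\<integral>\<^sup>+y. (k x y)\<^sup>2 \<partial>M) * (\<integral>\<^sup>+y. (v y)\<^sup>2 \<partial>M)"
        by (rule Cauchy_Schwarz_nn_integral) measurable
      ultimately show "(\<integral>\<^sup>+y. k x y * v y \<partial>M)\<^sup>2 \<le> ennreal ((max K 0)\<^sup>2 * m) * (\<integral>\<^sup>+x. (v x)\<^sup>2 \<partial>M)"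
        by (meson mult_right_mono order_trans zero_le)
    qed
    also have "\<dots> = ennreal (((max K 0)\<^sup>2 * m) * m) * (\<integral>\<^sup>+x. (v x)\<^sup>2 \<partial>M)"
      using m by (simp add: ennreal_mult mult_ac)
    finally show "(\<integral>\<^sup>+x. (\<integral>\<^sup>+y. k x y * v y \<partial>M)\<^sup>2 \<partial>M) \<le> \<dots>" .
  qed
  then have ne: "S \<noteq> {}" by blast
  have bb: "bdd_below S" unfolding S_def by (rule bdd_belowI[of _ 0]) auto
  define e where "e = Inf S"
  have e0: "0 \<le> e" unfolding e_def using ne by (rule cInf_greatest) (auto simp: S_def)
  have eS: "e \<in> S"
    unfolding S_def
  proof (intro CollectI conjI ballI impI e0)
    fix v :: "'a \<Rightarrow> ennreal" assume vm: "v \<in> borel_measurable M" and fin: "(\<integral>\<^sup>+x. (v x)\<^sup>2 \<partial>M) < \<infinity>"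
    let ?I = "\<integral>\<^sup>+x. (\<integral>\<^sup>+y. k x y * v y \<partial>M)\<^sup>2 \<partial>M"
    obtain V where V: "(\<integral>\<^sup>+x. (v x)\<^sup>2 \<partial>M) = ennreal V" "0 \<le> V"
      using fin by (cases "\<integral>\<^sup>+x. (v x)\<^sup>2 \<partial>M") auto
    have le: "?I \<le> ennreal (E * V)" if "E \<in> S" for E
    proof -
      have "0 \<le> E" "?I \<le> ennreal E * (\<integral>\<^sup>+x. (v x)\<^sup>2 \<partial>M)"
        using that fin vm unfolding S_def by blast+
      then show ?thesis using V by (simp add: ennreal_mult)
    qed
    obtain E0 where "E0 \<in> S" using ne by blast
    then have "?I < \<infinity>" by (rule le_less_trans[OF le]) simp
    then obtain I where I: "?I = ennreal I" "0 \<le> I"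
      by (cases ?I) auto
    have le': "I \<le> E * V" if "E \<in> S" for E
      using le[OF that] V that unfolding I S_def by (auto simp: ennreal_le_iff)
    have "I \<le> e * V"
    proof (cases "V = 0")
      case True
      then show ?thesis using le'[OF \<open>E0 \<in> S\<close>] by simp
    next
      case False
      then have "I / V \<le> e" unfolding e_def using V ne le'
        by (intro cInf_greatest) (auto simp: divide_le_eq)
      then show ?thesis using False V by (simp add: divide_le_eq)
    qed
    then show "?I \<le> ennreal e * (\<integral>\<^sup>+x. (v x)\<^sup>2 \<partial>M)"
      unfolding I V using e0 V by (simp flip: ennreal_mult)
  qed
  have all: "(\<integral>\<^sup>+x. (\<integral>\<^sup>+y. k x y * v y \<partial>M)\<^sup>2 \<partial>M) \<le> ennreal E * (\<integral>\<^sup>+x. (v x)\<^sup>2 \<partial>M)"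
    if "E \<in> S" "E > 0" "v \<in> borel_measurable M" for E and v :: "'a \<Rightarrow> ennreal"
    using that unfolding S_def by (cases "(\<integral>\<^sup>+x. (v x)\<^sup>2 \<partial>M) < \<infinity>") (auto simp: ennreal_mult_top not_less top_unique)
  have "e \<le> 4 * B\<^sup>2"
  proof (cases "e = 0")
    case False
    then have epos: "e > 0" using e0 by simp
    have "2 * B * sqrt e \<in> S"
      unfolding S_def
    proof (intro CollectI conjI ballI impI)
      fix v :: "'a \<Rightarrow> ennreal" assume v: "v \<in> borel_measurable M" and fin: "(\<integral>\<^sup>+x. (v x)\<^sup>2 \<partial>M) < \<infinity>"
      show "(\<integral>\<^sup>+x. (\<integral>\<^sup>+y. k x y * v y \<partial>M)\<^sup>2 \<partial>M) \<le> ennreal (2 * B * sqrt e) * (\<integral>\<^sup>+x. (v x)\<^sup>2 \<partial>M)"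
        by (rule quasi_selfadjoint_L2_step[OF k comp _ e0 all[OF eS epos] v fin]) (use B in auto)
    qed (use B e0 in auto)
    then have "e \<le> 2 * B * sqrt e"
      unfolding e_def using bb by (intro cInf_lower) auto
    then have "sqrt e * sqrt e \<le> (2 * B) * sqrt e" using e0 by simp
    then have "sqrt e \<le> 2 * B"
      by (rule mult_right_le_imp_le) (use epos in simp)
    then have "(sqrt e)\<^sup>2 \<le> (2 * B)\<^sup>2" using e0 by (intro power_mono) auto
    then show ?thesis using e0 by (simp add: power_mult_distrib)
  qed simp
  have "4 * B\<^sup>2 \<in> S"
    unfolding S_def
  proof (intro CollectI conjI ballI impI)
    fix v :: "'a \<Rightarrow> ennreal" assume vm: "v \<in> borel_measurable M" and fin: "(\<integral>\<^sup>+x. (v x)\<^sup>2 \<partial>M) < \<infinity>"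
    have "(\<integral>\<^sup>+x. (\<integral>\<^sup>+y. k x y * v y \<partial>M)\<^sup>2 \<partial>M) \<le> ennreal e * (\<integral>\<^sup>+x. (v x)\<^sup>2 \<partial>M)"
      using eS vm fin unfolding S_def by blast
    also have "\<dots> \<le> ennreal (4 * B\<^sup>2) * (\<integral>\<^sup>+x. (v x)\<^sup>2 \<partial>M)"
      using \<open>e \<le> 4 * B\<^sup>2\<close> by (intro mult_right_mono ennreal_leI) auto
    finally show "(\<integral>\<^sup>+x. (\<integral>\<^sup>+y. k x y * v y \<partial>M)\<^sup>2 \<partial>M) \<le> \<dots>" .
  qed simp
  then show ?thesis
    by (rule all) (use B v in auto)
qed

text \<open>
  Since \<open>poisson \<eta>\<close> agrees on the circle with the real part of \<open>(1 + \<eta>\<^sup>* w) / (1 - \<eta>\<^sup>* w)\<close>, where \<open>\<eta>\<^sup>*\<close>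
  is the conjugate of \<open>\<eta>\<close>, the Poisson formula evaluates the integral. The right-hand side is the
  Poisson kernel of the product \<open>\<eta>\<^sup>* \<zeta>\<close> at the point \<open>1\<close>.
\<close>

lemma poisson_convolution:
  assumes z: "norm \<zeta> < 1" "norm \<eta> < 1"
  shows "(\<integral>w. poisson \<zeta> w * poisson \<eta> w \<partial>circle) = (1 - (norm \<eta> * norm \<zeta>)\<^sup>2) / (norm (1 - cnj \<eta> * \<zeta>))\<^sup>2"
proof -
  have nz: "1 - cnj \<eta> * w \<noteq> 0" if "norm w \<le> 1" for w
  proof
    assume "1 - cnj \<eta> * w = 0"
    then have "norm (cnj \<eta> * w) = 1" by simp
    moreover have "norm (cnj \<eta> * w) \<le> norm \<eta> * 1"
      unfolding norm_mult using that by (intro mult_mono) auto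
    ultimately show False using z by simp
  qed
  \<comment> \<open>Its real part is the Poisson kernel of \<open>\<eta>\<close> on the circle.\<close>
  define G where "G w = (1 + cnj \<eta> * w) / (1 - cnj \<eta> * w)" for w
  have ReG: "Re (G w) = (1 - (norm \<eta> * norm w)\<^sup>2) / (norm (1 - cnj \<eta> * w))\<^sup>2" for w
  proof -
    have "Re ((1 + u) / (1 - u)) = (1 - (norm u)\<^sup>2) / (norm (1 - u))\<^sup>2" for u :: complex
      unfolding Re_divide cmod_power2 by (simp add: power2_eq_square algebra_simps)
    from this[of "cnj \<eta> * w"] show ?thesis by (simp add: G_def norm_mult)
  qed
  have P\<eta>: "poisson \<eta> w = Re (G w)" if "norm w = 1" for w
  proof -
    have "norm (w - \<eta>) = norm (1 - cnj \<eta> * w)"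
      using blaschke_identity[of \<eta> w] that by simp
    then show ?thesis using that by (simp add: ReG poisson_def)
  qed
  have cont: "continuous_on (cball 0 1) G"
    unfolding G_def using nz by (intro continuous_intros) auto
  have hol: "G holomorphic_on ball 0 1"
    unfolding G_def using nz by (intro holomorphic_intros) auto
  have cont': "continuous_on (sphere 0 1) G"
    by (rule continuous_on_subset[OF cont]) auto
  have int: "integrable circle (\<lambda>w. of_real (poisson \<zeta> w) * G w)"
    by (intro integrable_circle_continuous continuous_intros continuous_on_poisson z cont')
  have "(\<integral>w. poisson \<zeta> w * poisson \<eta> w \<partial>circle) = (\<integral>w. Re (of_real (poisson \<zeta> w) * G w) \<partial>circle)"
    by (intro Bochner_Integration.integral_cong) (auto simp: P\<eta>)
  also have "\<dots> = Re (\<integral>w. of_real (poisson \<zeta> w) * G w \<partial>circle)"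
    by (rule integral_Re[OF int])
  also have "(\<integral>w. of_real (poisson \<zeta> w) * G w \<partial>circle) = G \<zeta>"
    by (rule poisson_formula[OF cont hol z(1)])
  finally show ?thesis by (simp add: ReG)
qed

text \<open>
  For \<open>a \<le> b\<close> the distances \<open>1 - a\<close> and \<open>1 - ab\<close> are comparable, so passing from \<open>a\<close> to \<open>ab\<close> at most
  doubles the numerator \<open>1 - a\<^sup>2\<close> and at most halves the distance in the denominator.
\<close>

lemma poisson_kernel_radii_le:
  fixes u :: complex
  assumes ab: "0 \<le> a" "a \<le> b" "b < 1" and u: "norm u = 1"
  shows "(1 - (b * a)\<^sup>2) / (norm (1 - of_real (b * a) * u))\<^sup>2 \<le> 8 * ((1 - a\<^sup>2) / (norm (1 - of_real a * u))\<^sup>2)"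
proof -
  have ab1: "b * a \<le> a" using ab by (simp add: mult_left_le_one_le)
  have "norm (of_real (b * a) * u) = b * a"
    unfolding norm_mult norm_of_real using u ab by simp
  then have "1 - a \<le> norm (1 - of_real (b * a) * u)"
    using norm_triangle_ineq2[of 1 "of_real (b * a) * u"] ab1 unfolding norm_one by linarith
  have "norm (1 - of_real a * u) \<le> norm (1 - of_real (b * a) * u) + norm (of_real (a * (1 - b)) * u)"
    using norm_triangle_ineq4[of "1 - of_real (b * a) * u" "of_real (a * (1 - b)) * u"]
    by (simp add: algebra_simps)
  also have "norm (of_real (a * (1 - b)) * u) = a * (1 - b)"
    unfolding norm_mult norm_of_real using u ab by simp
  also have "a * (1 - b) \<le> 1 * (1 - a)"
    using ab by (intro mult_mono) auto
  also have "1 * (1 - a) \<le> norm (1 - of_real (b * a) * u)"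
    using \<open>1 - a \<le> _\<close> by simp
  finally have n: "norm (1 - of_real a * u) \<le> 2 * norm (1 - of_real (b * a) * u)" by simp
  have pos: "0 < norm (1 - of_real (b * a) * u)" "0 < norm (1 - of_real a * u)"
    using \<open>1 - a \<le> norm (1 - of_real (b * a) * u)\<close> ab
      norm_triangle_ineq2[of 1 "of_real a * u"] u by (auto simp: norm_mult)
  have "a\<^sup>2 \<le> b * a"
    using ab by (simp add: power2_eq_square mult_right_mono)
  then have "(a\<^sup>2)\<^sup>2 \<le> (b * a)\<^sup>2" by (intro power_mono) auto
  then have "1 - (b * a)\<^sup>2 \<le> (1 - a\<^sup>2) * (1 + a\<^sup>2)"
    by (simp add: algebra_simps power2_eq_square)
  also have "\<dots> \<le> (1 - a\<^sup>2) * 2"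
    using ab by (intro mult_left_mono) (auto simp: power_le_one)
  finally have top: "1 - (b * a)\<^sup>2 \<le> 2 * (1 - a\<^sup>2)" by simp
  have bot: "(norm (1 - of_real a * u))\<^sup>2 \<le> 4 * (norm (1 - of_real (b * a) * u))\<^sup>2"
    using power_mono[OF n, of 2] by (simp add: power_mult_distrib)
  have a2: "0 \<le> 1 - a\<^sup>2" using ab by (simp add: power_le_one)
  have "(1 - (b * a)\<^sup>2) * (norm (1 - of_real a * u))\<^sup>2
      \<le> (2 * (1 - a\<^sup>2)) * (4 * (norm (1 - of_real (b * a) * u))\<^sup>2)"
    using a2 by (intro mult_mono top bot) auto
  moreover have "t / Y \<le> 8 * (c / X)" if "t * X \<le> (2 * c) * (4 * Y)" "0 < X" "0 < Y" for t c X Y :: real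
    using that by (simp add: field_simps)
  ultimately show ?thesis
    using pos zero_less_power by blast
qed

text \<open>
  The hypothesis of \<open>quasi_selfadjoint_L2_bound\<close> for Poisson kernels with variable radius: of the two
  terms on the right, the one with the smaller radius already suffices.
\<close>

lemma poisson_convolution_le:
  assumes ab: "0 \<le> a" "a < 1" "0 \<le> b" "b < 1" and z: "norm z = 1" "norm z' = 1"
  shows "(\<integral>w. poisson (of_real a * z) w * poisson (of_real b * z') w \<partial>circle)
    \<le> 8 * (poisson (of_real a * z) z' + poisson (of_real b * z') z)"
proof -
  have unit: "norm (x - of_real c * y) = norm (1 - of_real c * (cnj x * y))"
    if "norm x = 1" for x y :: complex and c
  proof -
    have "x * cnj x = 1" using that by (simp add: complex_norm_square[symmetric])
    moreover have "x * (1 - of_real c * (cnj x * y)) = x - of_real c * ((x * cnj x) * y)"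
      by (simp add: algebra_simps)
    ultimately have "x - of_real c * y = x * (1 - of_real c * (cnj x * y))"
      by (simp only: mult_1)
    then show ?thesis using that by (simp add: norm_mult)
  qed
  have C: "(\<integral>w. poisson (of_real a * z) w * poisson (of_real b * z') w \<partial>circle)
      = (1 - (b * a)\<^sup>2) / (norm (1 - of_real (b * a) * (cnj z' * z)))\<^sup>2"
    using ab z by (subst poisson_convolution) (auto simp: norm_mult abs_of_nonneg mult_ac)
  have P1: "poisson (of_real a * z) z' = (1 - a\<^sup>2) / (norm (1 - of_real a * (cnj z' * z)))\<^sup>2"
    unfolding poisson_def using unit[of z' a z] ab z by (simp add: norm_mult)
  have P2: "poisson (of_real b * z') z = (1 - b\<^sup>2) / (norm (1 - of_real b * (cnj z' * z)))\<^sup>2"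
  proof -
    have "norm (1 - of_real b * (cnj z * z')) = norm (cnj (1 - of_real b * (cnj z * z')))"
      by (rule complex_mod_cnj[symmetric])
    also have "\<dots> = norm (1 - of_real b * (cnj z' * z))" by (simp add: mult.commute)
    finally show ?thesis unfolding poisson_def using unit[of z b z'] ab z by (simp add: norm_mult)
  qed
  have nn: "0 \<le> poisson (of_real a * z) z'" "0 \<le> poisson (of_real b * z') z"
    using ab z by (auto intro!: poisson_nonneg simp: norm_mult)
  have u: "norm (cnj z' * z) = 1" using z by (simp add: norm_mult)
  show ?thesis
  proof (cases "a \<le> b")
    case True
    have "(\<integral>w. poisson (of_real a * z) w * poisson (of_real b * z') w \<partial>circle) \<le> 8 * poisson (of_real a * z) z'"
      unfolding C P1 by (rule poisson_kernel_radii_le) (use ab True u in auto)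
    then show ?thesis using nn by simp
  next
    case False
    have "(\<integral>w. poisson (of_real a * z) w * poisson (of_real b * z') w \<partial>circle) \<le> 8 * poisson (of_real b * z') z"
      unfolding C P2 mult.commute[of b a] by (rule poisson_kernel_radii_le) (use ab False u in auto)
    then show ?thesis using nn by simp
  qed
qed

text \<open>
  Measurability of \<open>x \<mapsto> g (\<rho> x) x\<close> belongs to the conclusion because the induction step compares this
  function with the next \<open>g a\<close> to decide where the selection changes.
\<close>

lemma measurable_selection_of_finite_max:
  fixes g :: "'i::t1_space \<Rightarrow> 'a \<Rightarrow> ennreal"
  assumes "finite A" "A \<noteq> {}" and g: "\<And>a. a \<in> A \<Longrightarrow> g a \<in> borel_measurable M"
  shows "\<exists>\<rho>\<in>borel_measurable M. (\<forall>x. \<rho> x \<in> A) \<and> (\<forall>x. \<forall>a\<in>A. g a x \<le> g (\<rho> x) x) \<and>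
    (\<lambda>x. g (\<rho> x) x) \<in> borel_measurable M"
  using assms
proof (induction rule: finite_ne_induct)
  case (singleton a)
  then show ?case by (intro bexI[of _ "\<lambda>_. a"]) auto
next
  case (insert a A)
  have "\<exists>\<rho>\<in>borel_measurable M. (\<forall>x. \<rho> x \<in> A) \<and> (\<forall>x. \<forall>a\<in>A. g a x \<le> g (\<rho> x) x) \<and>
    (\<lambda>x. g (\<rho> x) x) \<in> borel_measurable M"
    using insert.prems by (intro insert.IH) auto
  then obtain \<rho> where \<rho>[measurable]: "\<rho> \<in> borel_measurable M"
    and \<rho>': "\<forall>x. \<rho> x \<in> A" "\<forall>x. \<forall>a\<in>A. g a x \<le> g (\<rho> x) x"
    and [measurable]: "(\<lambda>x. g (\<rho> x) x) \<in> borel_measurable M" by blast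
  have [measurable]: "g a \<in> borel_measurable M" using insert.prems by simp
  let ?\<rho> = "\<lambda>x. if g (\<rho> x) x \<le> g a x then a else \<rho> x"
  have "(\<lambda>x. g (?\<rho> x) x) = (\<lambda>x. if g (\<rho> x) x \<le> g a x then g a x else g (\<rho> x) x)"
    by auto
  moreover have "\<dots> \<in> borel_measurable M" by measurable
  ultimately have "(\<lambda>x. g (?\<rho> x) x) \<in> borel_measurable M" by simp
  moreover have "?\<rho> \<in> borel_measurable M" by measurable
  moreover have "\<forall>x. \<forall>b\<in>insert a A. g b x \<le> g (?\<rho> x) x"
    using \<rho>'(2) by (auto intro: order_trans less_imp_le)
  ultimately show ?case using \<rho>'(1) by (intro bexI[of _ ?\<rho>]) auto
qed

lemma borel_measurable_ident_circle: "(\<lambda>z. z) \<in> borel_measurable circle"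
  by (rule borel_measurable_circle_continuous) (intro continuous_intros)

text \<open>
  The maximum is linearised: at each point a radius \<open>\<rho> z\<close> attaining it is selected measurably, and the
  resulting linear operator is bounded independently of the finite set of radii.
\<close>

lemma poisson_maximal_finite:
  assumes A: "finite A" "A \<subseteq> {0..<1}" and [measurable]: "u \<in> borel_measurable circle"
  shows "(\<integral>\<^sup>+z. (SUP a\<in>A. \<integral>\<^sup>+w. ennreal (poisson (of_real a * z) w) * u w \<partial>circle)\<^sup>2 \<partial>circle)
    \<le> 256 * (\<integral>\<^sup>+z. (u z)\<^sup>2 \<partial>circle)"
proof (cases "A = {}")
  case True
  then show ?thesis by (simp add: bot_ennreal)
next
  case False
  note [measurable] = borel_measurable_ident_circle
  define g where "g a z = (\<integral>\<^sup>+w. ennreal (poisson (of_real a * z) w) * u w \<partial>circle)" for a z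
  have g[measurable]: "g a \<in> borel_measurable circle" for a
    unfolding g_def poisson_def by measurable
  from measurable_selection_of_finite_max[OF A(1) False, of g circle] obtain \<rho> where
    \<rho>[measurable]: "\<rho> \<in> borel_measurable circle" and \<rho>A: "\<And>x. \<rho> x \<in> A"
    and \<rho>max: "\<And>x a. a \<in> A \<Longrightarrow> g a x \<le> g (\<rho> x) x" by auto
  have \<rho>01: "0 \<le> \<rho> x" "\<rho> x < 1" for x using \<rho>A[of x] A(2) by auto
  have \<rho>norm: "norm (of_real (\<rho> z) * z) < 1" if "norm z = 1" for z
    using \<rho>01[of z] that by (simp add: norm_mult)
  \<comment> \<open>The variable radius makes this kernel non-symmetric.\<close>
  define k where "k z w = ennreal (poisson (of_real (\<rho> z) * z) w)" for z w
  have k: "(\<lambda>(z, w). k z w) \<in> borel_measurable (circle \<Otimes>\<^sub>M circle)"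
    unfolding k_def poisson_def by measurable
  have comp: "(\<integral>\<^sup>+w. k z w * k z' w \<partial>circle) \<le> ennreal 8 * (k z z' + k z' z)"
    if "z \<in> space circle" "z' \<in> space circle" for z z'
  proof -
    have z: "norm z = 1" "norm z' = 1" using that by auto
    have nn: "0 \<le> poisson (of_real (\<rho> z) * z) w" if "norm z = 1" for z w
      using \<rho>norm[OF that] by (intro poisson_nonneg) auto
    have "(\<integral>\<^sup>+w. k z w * k z' w \<partial>circle) =
        (\<integral>\<^sup>+w. ennreal (poisson (of_real (\<rho> z) * z) w * poisson (of_real (\<rho> z') * z') w) \<partial>circle)"
      unfolding k_def by (intro nn_integral_cong) (simp add: ennreal_mult nn z)
    also have "\<dots> = ennreal (\<integral>w. poisson (of_real (\<rho> z) * z) w * poisson (of_real (\<rho> z') * z') w \<partial>circle)"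
      by (intro nn_integral_eq_integral integrable_circle_continuous continuous_intros
          continuous_on_poisson \<rho>norm z AE_I2 mult_nonneg_nonneg nn)
    also have "\<dots> \<le> ennreal (8 * (poisson (of_real (\<rho> z) * z) z' + poisson (of_real (\<rho> z') * z') z))"
      by (intro ennreal_leI poisson_convolution_le \<rho>01 z)
    also have "\<dots> = ennreal 8 * (k z z' + k z' z)"
      unfolding k_def using nn z by (simp add: ennreal_mult ennreal_plus)
    finally show ?thesis .
  qed
  define K where "K = 2 / (1 - Max A)"
  have bdd: "k z w \<le> ennreal K" if "z \<in> space circle" "w \<in> space circle" for z w
  proof -
    have z: "norm z = 1" "norm w = 1" using that by auto
    have "\<rho> z \<le> Max A" using A(1) \<rho>A[of z] by (rule Max_ge)
    moreover have "Max A < 1" using Max_in[OF A(1) False] A(2) by auto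
    ultimately have "2 / (1 - norm (of_real (\<rho> z) * z)) \<le> K"
      unfolding K_def using \<rho>01[of z] z by (intro divide_left_mono) (auto simp: norm_mult)
    then show ?thesis
      unfolding k_def using poisson_le[OF \<rho>norm[OF z(1)] z(2)] by (intro ennreal_leI) linarith
  qed
  have "(\<integral>\<^sup>+z. (SUP a\<in>A. g a z)\<^sup>2 \<partial>circle) \<le> (\<integral>\<^sup>+z. (\<integral>\<^sup>+w. k z w * u w \<partial>circle)\<^sup>2 \<partial>circle)"
    using \<rho>max by (intro nn_integral_mono power_mono SUP_least) (auto simp: g_def k_def)
  also have "\<dots> \<le> ennreal (4 * 8\<^sup>2) * (\<integral>\<^sup>+z. (u z)\<^sup>2 \<partial>circle)"
    by (rule circle.quasi_selfadjoint_L2_bound[OF k comp bdd]) auto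
  finally show ?thesis unfolding g_def by simp
qed

section \<open>The radial maximal function\<close>

definition hardy_max :: "real \<Rightarrow> (complex \<Rightarrow> complex) \<Rightarrow> complex \<Rightarrow> ennreal" where
  "hardy_max r F z = (SUP a\<in>{0..<1}. ennreal (norm (F (of_real a * z)) powr r))"

lemma hardy_max_upper:
  "0 \<le> a \<Longrightarrow> a < 1 \<Longrightarrow> ennreal (norm (F (of_real a * z)) powr r) \<le> hardy_max r F z"
  unfolding hardy_max_def by (rule SUP_upper) auto

lemma tendsto_radial:
  assumes hol: "F holomorphic_on ball 0 1" and lim: "(a \<longlongrightarrow> b) X" and b: "norm (of_real b * z) < 1"
  shows "((\<lambda>n. F (of_real (a n) * z)) \<longlongrightarrow> F (of_real b * z)) X"
proof (rule isCont_tendsto_compose[of _ F])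
  show "isCont F (of_real b * z)"
    using holomorphic_on_imp_continuous_on[OF hol] b
    by (intro continuous_on_interior[of "ball 0 1"]) auto
qed (intro tendsto_intros lim)

text \<open>
  By continuity of \<open>F\<close> along the radius; the countable supremum gives measurability.
\<close>

lemma hardy_max_rational:
  assumes hol: "F holomorphic_on ball 0 1" and z: "norm z = 1" and r: "0 < r"
  shows "hardy_max r F z = (SUP a\<in>\<rat> \<inter> {0..<1}. ennreal (norm (F (of_real a * z)) powr r))"
    (is "_ = ?S")
proof (rule antisym)
  show "?S \<le> hardy_max r F z"
    unfolding hardy_max_def by (rule SUP_subset_mono) auto
  show "hardy_max r F z \<le> ?S"
    unfolding hardy_max_def
  proof (rule SUP_least)
    fix a :: real assume a: "a \<in> {0..<1}"
    have "\<exists>q\<in>\<rat>. a < q \<and> q < a + (1 - a) * inverse (real (Suc n))" for n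
      using a by (intro Rats_dense_in_real) auto
    then obtain q where q: "\<And>n. q n \<in> \<rat>" "\<And>n. a < q n" "\<And>n. q n < a + (1 - a) * inverse (real (Suc n))"
      by metis
    have lim: "(\<lambda>n. a + (1 - a) * inverse (real (Suc n))) \<longlonglongrightarrow> a + (1 - a) * 0"
      by (intro tendsto_intros LIMSEQ_inverse_real_of_nat)
    have qlim: "q \<longlonglongrightarrow> a"
      by (rule tendsto_sandwich[OF _ _ tendsto_const[of a] lim[simplified]])
        (use q(2,3) in \<open>auto intro!: always_eventually less_imp_le simp: inverse_eq_divide\<close>)
    have q1: "q n \<in> \<rat> \<inter> {0..<1}" for n
    proof -
      have "(1 - a) * inverse (real (Suc n)) \<le> (1 - a) * 1"
        using a by (intro mult_left_mono) (auto simp: inverse_eq_divide)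
      then show ?thesis using q(1)[of n] q(2)[of n] q(3)[of n] a by auto
    qed
    show "ennreal (norm (F (of_real a * z)) powr r) \<le> ?S"
    proof (rule LIMSEQ_le_const2)
      show "(\<lambda>n. ennreal (norm (F (of_real (q n) * z)) powr r)) \<longlonglongrightarrow> ennreal (norm (F (of_real a * z)) powr r)"
        by (intro tendsto_ennrealI tendsto_norm_powr r tendsto_radial hol qlim)
          (use a z in \<open>simp add: norm_mult\<close>)
      show "\<exists>N. \<forall>n\<ge>N. ennreal (norm (F (of_real (q n) * z)) powr r) \<le> ?S"
        using q1 by (intro exI[of _ 0] allI impI SUP_upper) auto
    qed
  qed
qed

lemma continuous_on_sphere_dilate:
  assumes hol: "F holomorphic_on ball 0 1" and R: "0 \<le> R" "R < 1"
  shows "continuous_on (sphere 0 1) (\<lambda>z. F (of_real R * z))"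
  by (rule continuous_on_compose2[OF holomorphic_on_imp_continuous_on[OF hol]])
    (use R in \<open>auto intro!: continuous_intros simp: norm_mult\<close>)

lemma borel_measurable_hardy_max:
  assumes hol: "F holomorphic_on ball 0 1" and r: "0 < r"
  shows "hardy_max r F \<in> borel_measurable circle"
proof -
  have "(\<lambda>z. SUP a\<in>\<rat> \<inter> {0..<1}. ennreal (norm (F (of_real a * z)) powr r)) \<in> borel_measurable circle"
  proof (rule borel_measurable_SUP)
    show "countable (\<rat> \<inter> {0..<1::real})" using countable_rat by blast
    fix a :: real assume "a \<in> \<rat> \<inter> {0..<1}"
    then show "(\<lambda>z. ennreal (norm (F (of_real a * z)) powr r)) \<in> borel_measurable circle"
      by (intro measurable_compose[OF _ measurable_ennreal] borel_measurable_circle_continuous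
          continuous_on_norm_powr continuous_on_sphere_dilate hol r) auto
  qed
  then show ?thesis
    by (rule measurable_cong[THEN iffD1, rotated]) (simp add: hardy_max_rational[OF hol _ r])
qed

lemma ennreal_norm_powr_half_sq: "(ennreal (norm x powr (r / 2)))\<^sup>2 = ennreal (norm x powr r)"
proof -
  have "(norm x powr (r / 2))\<^sup>2 = norm x powr r"
    by (simp add: power2_eq_square flip: powr_add)
  then show ?thesis by (simp add: ennreal_power)
qed

text \<open>
  At every radius \<open>|F|\<^bsup>r/2\<^esup>\<close> is at most the Poisson integral of its values on the circle, so the
  radial maximal function is at most the square of a maximal Poisson integral. Finite sets of rational
  radii exhaust the supremum.
\<close>

lemma nn_integral_hardy_max_closed_disc:
  assumes hol: "F holomorphic_on ball 0 R" and R: "R > 1" and r: "0 < r" "r \<le> 1"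
  shows "(\<integral>\<^sup>+z. hardy_max r F z \<partial>circle) \<le> 256 * (\<integral>\<^sup>+z. ennreal (norm (F z) powr r) \<partial>circle)"
proof -
  define Q where "Q = \<rat> \<inter> {0..<1::real}"
  define A where "A n = from_nat_into Q ` {..n}" for n
  have "0 \<in> Q" by (auto simp: Q_def)
  then have Qne: "Q \<noteq> {}" by auto
  have Qc: "countable Q" unfolding Q_def using countable_rat by blast
  have AQ: "A n \<subseteq> Q" for n unfolding A_def using from_nat_into[OF Qne] by auto
  have A01: "A n \<subseteq> {0..<1}" for n using AQ[of n] by (auto simp: Q_def)
  have AU: "(\<Union>n. A n) = Q"
  proof
    show "Q \<subseteq> (\<Union>n. A n)"
    proof
      fix a assume "a \<in> Q"
      then have "a = from_nat_into Q (to_nat_on Q a)" using Qc by simp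
      then show "a \<in> (\<Union>n. A n)" unfolding A_def by auto
    qed
  qed (use AQ in auto)
  have hol1: "F holomorphic_on ball 0 1"
    by (rule holomorphic_on_subset[OF hol]) (use R in auto)
  have contF: "continuous_on (sphere 0 1) F"
    by (rule continuous_on_subset[OF holomorphic_on_imp_continuous_on[OF hol]]) (use R in auto)
  define \<phi> where "\<phi> a z = ennreal (norm (F (of_real a * z)) powr r)" for a z
  define u where "u z = ennreal (norm (F z) powr (r / 2))" for z
  have um[measurable]: "u \<in> borel_measurable circle"
    unfolding u_def using r
    by (intro measurable_compose[OF _ measurable_ennreal] borel_measurable_circle_continuous
          continuous_on_norm_powr contF) auto
  have \<phi>m[measurable]: "\<phi> a \<in> borel_measurable circle" if "a \<in> Q" for a
    unfolding \<phi>_def using r that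
    by (intro measurable_compose[OF _ measurable_ennreal] borel_measurable_circle_continuous
          continuous_on_norm_powr continuous_on_sphere_dilate hol1) (auto simp: Q_def)
  have u2: "(u z)\<^sup>2 = ennreal (norm (F z) powr r)" for z
    unfolding u_def by (rule ennreal_norm_powr_half_sq)
  have pt: "\<phi> a z \<le> (\<integral>\<^sup>+w. ennreal (poisson (of_real a * z) w) * u w \<partial>circle)\<^sup>2"
    if a: "a \<in> {0..<1}" and z: "norm z = 1" for a z
  proof -
    have n: "norm (of_real a * z) < 1" using a z by (simp add: norm_mult)
    have "ennreal (norm (F (of_real a * z)) powr (r / 2))
        \<le> ennreal (\<integral>w. poisson (of_real a * z) w * norm (F w) powr (r / 2) \<partial>circle)"
      by (intro ennreal_leI norm_powr_le_poisson[OF hol R n]) (use r in auto)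
    also have "\<dots> = (\<integral>\<^sup>+w. ennreal (poisson (of_real a * z) w * norm (F w) powr (r / 2)) \<partial>circle)"
      using r n by (intro nn_integral_eq_integral[symmetric] integrable_circle_continuous continuous_intros
          continuous_on_poisson continuous_on_norm_powr contF AE_I2 mult_nonneg_nonneg poisson_nonneg) auto
    also have "\<dots> = (\<integral>\<^sup>+w. ennreal (poisson (of_real a * z) w) * u w \<partial>circle)"
      unfolding u_def using n by (intro nn_integral_cong) (simp add: ennreal_mult' poisson_nonneg)
    finally have "(ennreal (norm (F (of_real a * z)) powr (r / 2)))\<^sup>2 \<le> \<dots>\<^sup>2"
      by (intro power_mono) auto
    then show ?thesis unfolding ennreal_norm_powr_half_sq \<phi>_def .
  qed
  have fin: "(\<integral>\<^sup>+z. (SUP a\<in>A n. \<phi> a z) \<partial>circle) \<le> 256 * (\<integral>\<^sup>+z. ennreal (norm (F z) powr r) \<partial>circle)" for n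
  proof -
    have "(\<integral>\<^sup>+z. (SUP a\<in>A n. \<phi> a z) \<partial>circle) \<le>
        (\<integral>\<^sup>+z. (SUP a\<in>A n. \<integral>\<^sup>+w. ennreal (poisson (of_real a * z) w) * u w \<partial>circle)\<^sup>2 \<partial>circle)"
    proof (intro nn_integral_mono SUP_least)
      fix z a assume z: "z \<in> space circle" and a: "a \<in> A n"
      have "\<phi> a z \<le> (\<integral>\<^sup>+w. ennreal (poisson (of_real a * z) w) * u w \<partial>circle)\<^sup>2"
        by (rule pt[OF subsetD[OF A01 a]]) (use z in simp)
      also have "\<dots> \<le> (SUP a\<in>A n. \<integral>\<^sup>+w. ennreal (poisson (of_real a * z) w) * u w \<partial>circle)\<^sup>2"
        by (intro power_mono SUP_upper a) auto
      finally show "\<phi> a z \<le> \<dots>" .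
    qed
    also have "\<dots> \<le> 256 * (\<integral>\<^sup>+z. (u z)\<^sup>2 \<partial>circle)"
      by (rule poisson_maximal_finite[OF _ A01]) (auto simp: A_def)
    finally show ?thesis unfolding u2 .
  qed
  have "(\<integral>\<^sup>+z. hardy_max r F z \<partial>circle) = (\<integral>\<^sup>+z. (SUP n. SUP a\<in>A n. \<phi> a z) \<partial>circle)"
  proof (rule nn_integral_cong)
    fix z assume "z \<in> space circle"
    then have "hardy_max r F z = (SUP a\<in>Q. \<phi> a z)"
      unfolding Q_def \<phi>_def using hardy_max_rational[OF hol1 _ r(1)] by simp
    then show "hardy_max r F z = (SUP n. SUP a\<in>A n. \<phi> a z)"
      unfolding AU[symmetric] by (simp only: SUP_UNION)
  qed
  also have "\<dots> = (SUP n. \<integral>\<^sup>+z. (SUP a\<in>A n. \<phi> a z) \<partial>circle)"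
  proof (rule nn_integral_monotone_convergence_SUP)
    show "incseq (\<lambda>n z. SUP a\<in>A n. \<phi> a z)"
      by (intro incseq_SucI le_funI SUP_subset_mono) (auto simp: A_def)
    show "(\<lambda>z. SUP a\<in>A n. \<phi> a z) \<in> borel_measurable circle" for n
      using AQ[of n] by (intro borel_measurable_SUP \<phi>m) (auto simp: A_def)
  qed
  also have "\<dots> \<le> 256 * (\<integral>\<^sup>+z. ennreal (norm (F z) powr r) \<partial>circle)"
    by (intro SUP_least fin)
  finally show ?thesis .
qed

lemma holomorphic_dilate:
  assumes hol: "F holomorphic_on ball 0 1" and R: "0 < R"
  shows "(\<lambda>z. F (of_real R * z)) holomorphic_on ball 0 (1 / R)"
proof -
  have "(F \<circ> (\<lambda>z. of_real R * z)) holomorphic_on ball 0 (1 / R)"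
    by (rule holomorphic_on_compose_gen[OF _ hol])
      (use R in \<open>auto intro!: holomorphic_intros simp: norm_mult field_simps\<close>)
  then show ?thesis by (simp add: o_def)
qed

text \<open>
  The maximal function of \<open>F\<close> is at most the lower limit of the maximal functions of its dilates,
  which are holomorphic beyond the closed disc; Fatou's lemma concludes.
\<close>

lemma nn_integral_hardy_max_liminf:
  assumes hol: "F holomorphic_on ball 0 1" and r: "0 < r" "r \<le> 1"
  shows "(\<integral>\<^sup>+z. hardy_max r F z \<partial>circle)
    \<le> liminf (\<lambda>n. 256 * (\<integral>\<^sup>+z. ennreal (norm (F (of_real (radius n) * z)) powr r) \<partial>circle))"
proof -
  define G where "G n z = F (of_real (radius n) * z)" for n z
  have holG: "G n holomorphic_on ball 0 (1 / radius n)" for n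
    unfolding G_def by (rule holomorphic_dilate[OF hol]) (use radius_bounds in auto)
  have R: "1 / radius n > 1" for n using radius_bounds[of n] by simp
  have holG1: "G n holomorphic_on ball 0 1" for n
    using R[of n] by (intro holomorphic_on_subset[OF holG]) auto
  have "(\<integral>\<^sup>+z. hardy_max r F z \<partial>circle) \<le> (\<integral>\<^sup>+z. liminf (\<lambda>n. hardy_max r (G n) z) \<partial>circle)"
  proof (rule nn_integral_mono)
    fix z assume "z \<in> space circle"
    then have z: "norm z = 1" by simp
    show "hardy_max r F z \<le> liminf (\<lambda>n. hardy_max r (G n) z)"
      unfolding hardy_max_def[of r F]
    proof (rule SUP_least)
      fix a :: real assume a: "a \<in> {0..<1}"
      have "(\<lambda>n. F (of_real (radius n * a) * z)) \<longlonglongrightarrow> F (of_real (1 * a) * z)"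
        by (intro tendsto_radial hol tendsto_intros radius_tendsto) (use a z in \<open>simp add: norm_mult\<close>)
      then have "(\<lambda>n. ennreal (norm (G n (of_real a * z)) powr r)) \<longlonglongrightarrow> ennreal (norm (F (of_real a * z)) powr r)"
        unfolding G_def using r by (intro tendsto_ennrealI tendsto_norm_powr) (auto simp: mult.assoc)
      then have "ennreal (norm (F (of_real a * z)) powr r) = liminf (\<lambda>n. ennreal (norm (G n (of_real a * z)) powr r))"
        by (rule lim_imp_Liminf[OF trivial_limit_sequentially, symmetric])
      also have "\<dots> \<le> liminf (\<lambda>n. hardy_max r (G n) z)"
        by (intro Liminf_mono always_eventually allI hardy_max_upper) (use a in auto)
      finally show "ennreal (norm (F (of_real a * z)) powr r) \<le> liminf (\<lambda>n. hardy_max r (G n) z)" .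
    qed
  qed
  also have "\<dots> \<le> liminf (\<lambda>n. \<integral>\<^sup>+z. hardy_max r (G n) z \<partial>circle)"
    by (intro nn_integral_liminf borel_measurable_hardy_max holG1 r)
  also have "\<dots> \<le> liminf (\<lambda>n. 256 * (\<integral>\<^sup>+z. ennreal (norm (F (of_real (radius n) * z)) powr r) \<partial>circle))"
    unfolding G_def[symmetric]
    by (intro Liminf_mono always_eventually allI nn_integral_hardy_max_closed_disc[OF holG R] r)
  finally show ?thesis .
qed

lemma liminf_le_const:
  fixes X :: "nat \<Rightarrow> ennreal"
  assumes "eventually (\<lambda>n. X n \<le> C) sequentially"
  shows "liminf X \<le> C"
  using Liminf_le_Limsup[of sequentially X] Limsup_bounded[OF assms] by (auto intro: order_trans)

lemma integrable_norm_powr_dilate: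
  assumes "F holomorphic_on ball 0 1" "0 \<le> R" "R < 1" "0 < r"
  shows "integrable circle (\<lambda>z. norm (F (of_real R * z)) powr r)"
  by (intro integrable_circle_continuous continuous_on_norm_powr continuous_on_sphere_dilate assms)

lemma nn_integral_norm_powr_dilate:
  assumes "F holomorphic_on ball 0 1" "0 \<le> R" "R < 1" "0 < r"
  shows "(\<integral>\<^sup>+z. ennreal (norm (F (of_real R * z)) powr r) \<partial>circle)
    = ennreal (\<integral>z. norm (F (of_real R * z)) powr r \<partial>circle)"
  by (intro nn_integral_eq_integral integrable_norm_powr_dilate assms) auto

text \<open>
  Bounded circle means are equivalent to an integrable maximal function. In the second form, sums and
  limits are easy to handle.
\<close>

lemma Hr_disc_iff_hardy_max_finite:
  assumes r: "0 < r" "r \<le> 1"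
  shows "F \<in> Hr_disc r \<longleftrightarrow>
    F holomorphic_on ball 0 1 \<and> (\<integral>\<^sup>+z. hardy_max r F z \<partial>circle) < \<infinity>"
proof (cases "F holomorphic_on ball 0 1")
  case hol: True
  show ?thesis
  proof
    assume "F \<in> Hr_disc r"
    then obtain C where "\<forall>R\<in>{0..<1}. (\<integral>z. norm (F (of_real R * z)) powr r \<partial>circle) \<le> C"
      unfolding Hr_disc_def bdd_above_def by auto
    then have C: "(\<integral>z. norm (F (of_real R * z)) powr r \<partial>circle) \<le> C" if "R \<in> {0..<1}" for R
      using that by blast
    have "(\<integral>\<^sup>+z. hardy_max r F z \<partial>circle)
      \<le> liminf (\<lambda>n. 256 * (\<integral>\<^sup>+z. ennreal (norm (F (of_real (radius n) * z)) powr r) \<partial>circle))"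
      by (rule nn_integral_hardy_max_liminf[OF hol r])
    also have "\<dots> \<le> 256 * ennreal C"
    proof (intro liminf_le_const always_eventually allI mult_left_mono)
      fix n
      show "(\<integral>\<^sup>+z. ennreal (norm (F (of_real (radius n) * z)) powr r) \<partial>circle) \<le> ennreal C"
        using C[of "radius n"] radius_bounds[of n] r
        by (subst nn_integral_norm_powr_dilate[OF hol]) (auto intro!: ennreal_leI)
    qed auto
    also have "\<dots> < \<infinity>"
      using ennreal_mult_less_top[of 256 "ennreal C"] by simp
    finally show "F holomorphic_on ball 0 1 \<and> (\<integral>\<^sup>+z. hardy_max r F z \<partial>circle) < \<infinity>"
      using hol by simp
  next
    assume "F holomorphic_on ball 0 1 \<and> (\<integral>\<^sup>+z. hardy_max r F z \<partial>circle) < \<infinity>"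
    then obtain C where C: "(\<integral>\<^sup>+z. hardy_max r F z \<partial>circle) = ennreal C" "0 \<le> C"
      by (cases "\<integral>\<^sup>+z. hardy_max r F z \<partial>circle") auto
    have "(\<integral>z. norm (F (of_real R * z)) powr r \<partial>circle) \<le> C" if R: "R \<in> {0..<1}" for R
    proof -
      have "ennreal (\<integral>z. norm (F (of_real R * z)) powr r \<partial>circle)
          = (\<integral>\<^sup>+z. ennreal (norm (F (of_real R * z)) powr r) \<partial>circle)"
        using R r by (intro nn_integral_norm_powr_dilate[OF hol, symmetric]) auto
      also have "\<dots> \<le> (\<integral>\<^sup>+z. hardy_max r F z \<partial>circle)"
        using R by (intro nn_integral_mono hardy_max_upper) auto
      finally show ?thesis using C by simp
    qed
    then show "F \<in> Hr_disc r"
      using hol by (auto simp: Hr_disc_def intro!: bdd_aboveI2[where M = C])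
  qed
qed (simp add: Hr_disc_def)

section \<open>Boundary functions\<close>

text \<open>
  A membership certificate for the boundary space that exhibits the holomorphic extension; the results
  below relate \<open>f\<close> to this particular \<open>F\<close>.
\<close>

definition boundary_function :: "real \<Rightarrow> (complex \<Rightarrow> complex) \<Rightarrow> (complex \<Rightarrow> complex) \<Rightarrow> bool" where
  "boundary_function r F f \<longleftrightarrow> F \<in> Hr_disc r \<and> f \<in> borel_measurable circle \<and>
    (AE z in circle. ((\<lambda>R. F (of_real R * z)) \<longlongrightarrow> f z) (at_left 1))"

lemma Hr_circle_iff: "f \<in> Hr_circle r \<longleftrightarrow> (\<exists>F. boundary_function r F f)"
  unfolding Hr_circle_def boundary_function_def by auto

lemma boundary_functionD:
  assumes "boundary_function r F f"
  shows "F holomorphic_on ball 0 1" "F \<in> Hr_disc r" "f \<in> borel_measurable circle"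
    "AE z in circle. ((\<lambda>R. F (of_real R * z)) \<longlongrightarrow> f z) (at_left 1)"
  using assms by (auto simp: boundary_function_def Hr_disc_def)

lemma boundary_function_cong_AE:
  assumes "boundary_function r F f" "g \<in> borel_measurable circle" "AE z in circle. g z = f z"
  shows "boundary_function r F g"
proof -
  have "AE z in circle. ((\<lambda>R. F (of_real R * z)) \<longlongrightarrow> g z) (at_left 1)"
    using boundary_functionD(4)[OF assms(1)] assms(3) by eventually_elim simp
  then show ?thesis using assms by (simp add: boundary_function_def)
qed

lemma Hr_disc_add:
  assumes r: "0 < r" "r \<le> 1" and F: "F \<in> Hr_disc r" and G: "G \<in> Hr_disc r"
  shows "(\<lambda>z. F z + G z) \<in> Hr_disc r"
proof -
  have hol: "F holomorphic_on ball 0 1" "G holomorphic_on ball 0 1"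
    using F G by (auto simp: Hr_disc_def)
  have "(\<integral>\<^sup>+z. hardy_max r (\<lambda>z. F z + G z) z \<partial>circle) \<le> (\<integral>\<^sup>+z. hardy_max r F z + hardy_max r G z \<partial>circle)"
    unfolding hardy_max_def[of r "\<lambda>z. F z + G z"]
  proof (intro nn_integral_mono SUP_least)
    fix z a assume "a \<in> {0..<1::real}"
    then have a: "0 \<le> a" "a < 1" by auto
    have "ennreal (norm (F (of_real a * z) + G (of_real a * z)) powr r)
      \<le> ennreal (norm (F (of_real a * z)) powr r) + ennreal (norm (G (of_real a * z)) powr r)"
      using norm_add_powr_le[OF r] by (simp flip: ennreal_plus)
    also have "\<dots> \<le> hardy_max r F z + hardy_max r G z"
      by (intro add_mono hardy_max_upper a)
    finally show "ennreal (norm (F (of_real a * z) + G (of_real a * z)) powr r) \<le> hardy_max r F z + hardy_max r G z" .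
  qed
  also have "\<dots> = (\<integral>\<^sup>+z. hardy_max r F z \<partial>circle) + (\<integral>\<^sup>+z. hardy_max r G z \<partial>circle)"
    by (intro nn_integral_add borel_measurable_hardy_max hol r)
  also have "\<dots> < \<infinity>"
    using F G by (simp add: Hr_disc_iff_hardy_max_finite[OF r])
  finally show ?thesis
    using hol by (auto simp: Hr_disc_iff_hardy_max_finite[OF r] intro!: holomorphic_intros)
qed

lemma Hr_disc_uminus: "F \<in> Hr_disc r \<Longrightarrow> (\<lambda>z. - F z) \<in> Hr_disc r"
  by (auto simp: Hr_disc_def intro!: holomorphic_intros)

lemma boundary_function_add:
  assumes r: "0 < r" "r \<le> 1" and "boundary_function r F f" "boundary_function r G g"
  shows "boundary_function r (\<lambda>z. F z + G z) (\<lambda>z. f z + g z)"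
proof -
  have "AE z in circle. ((\<lambda>R. F (of_real R * z) + G (of_real R * z)) \<longlongrightarrow> f z + g z) (at_left 1)"
    using boundary_functionD(4)[OF assms(3)] boundary_functionD(4)[OF assms(4)]
    by eventually_elim (rule tendsto_add)
  then show ?thesis
    using assms Hr_disc_add[OF r] by (simp add: boundary_function_def borel_measurable_add)
qed

lemma boundary_function_uminus:
  assumes "boundary_function r F f"
  shows "boundary_function r (\<lambda>z. - F z) (\<lambda>z. - f z)"
proof -
  have "AE z in circle. ((\<lambda>R. - F (of_real R * z)) \<longlongrightarrow> - f z) (at_left 1)"
    using boundary_functionD(4)[OF assms] by eventually_elim (rule tendsto_minus)
  then show ?thesis
    using assms Hr_disc_uminus by (simp add: boundary_function_def)
qed

lemma boundary_function_diff:
  assumes "0 < r" "r \<le> 1" "boundary_function r F f" "boundary_function r G g"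
  shows "boundary_function r (\<lambda>z. F z - G z) (\<lambda>z. f z - g z)"
  using boundary_function_add[OF assms(1-3) boundary_function_uminus[OF assms(4)]] by simp

lemma boundary_function_continuous:
  assumes r: "0 < r" and hol: "F holomorphic_on ball 0 1" and cont: "continuous_on (cball 0 1) F"
  shows "boundary_function r F F"
proof -
  have "compact (F ` cball 0 1)"
    by (rule compact_continuous_image[OF cont]) auto
  then obtain B where B: "\<And>z. norm z \<le> 1 \<Longrightarrow> norm (F z) \<le> B"
    using compact_imp_bounded bounded_iff by (metis imageI mem_cball_0)
  have "(\<integral>z. norm (F (of_real R * z)) powr r \<partial>circle) \<le> B powr r" if R: "R \<in> {0..<1}" for R
  proof -
    have "(\<integral>z. norm (F (of_real R * z)) powr r \<partial>circle) \<le> (\<integral>z. B powr r \<partial>circle)"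
    proof (rule integral_mono)
      show "integrable circle (\<lambda>z. norm (F (of_real R * z)) powr r)"
        using R r by (intro integrable_norm_powr_dilate hol) auto
      fix z assume "z \<in> space circle"
      then have "norm (of_real R * z) \<le> 1" using R by (simp add: norm_mult)
      then show "norm (F (of_real R * z)) powr r \<le> B powr r"
        using B r by (intro powr_mono2) auto
    qed simp
    then show ?thesis by (simp add: measure_circle)
  qed
  then have "F \<in> Hr_disc r"
    using hol by (auto simp: Hr_disc_def intro!: bdd_aboveI2[where M = "B powr r"])
  moreover have "F \<in> borel_measurable circle"
    by (rule borel_measurable_circle_continuous[OF continuous_on_subset[OF cont]]) auto
  moreover have "((\<lambda>R. F (of_real R * z)) \<longlongrightarrow> F z) (at_left 1)" if z: "norm z = 1" for z
  proof -
    have "((\<lambda>R. of_real R * z) \<longlongrightarrow> of_real 1 * z) (at_left 1)"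
      by (intro tendsto_intros)
    moreover have "\<forall>\<^sub>F R in at_left (1::real). of_real R * z \<in> cball 0 1"
      using eventually_at_left_real[OF zero_less_one] by eventually_elim (use z in \<open>auto simp: norm_mult\<close>)
    ultimately show ?thesis
      using continuous_on_tendsto_compose[OF cont, of "\<lambda>R. of_real R * z" z "at_left 1"] z by simp
  qed
  ultimately show ?thesis unfolding boundary_function_def by auto
qed

lemma boundary_function_rotate:
  assumes c: "norm c = 1" and F: "boundary_function r F f"
  shows "boundary_function r (\<lambda>z. F (c * z)) (\<lambda>z. f (c * z))"
proof -
  note D = boundary_functionD[OF F]
  have "AE z in circle. ((\<lambda>R. F (of_real R * (c * z))) \<longlongrightarrow> f (c * z)) (at_left 1)"
    by (rule AE_circle_rotate[OF c D(4)])
  then have "AE z in circle. ((\<lambda>R. F (c * (of_real R * z))) \<longlongrightarrow> f (c * z)) (at_left 1)"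
    by (simp add: mult.left_commute)
  moreover have "(\<lambda>z. f (c * z)) \<in> borel_measurable circle"
    by (rule measurable_compose[OF measurable_rotate_circle[OF c] D(3)])
  moreover have "(\<lambda>z. F (c * z)) \<in> Hr_disc r"
  proof -
    have hol: "(F \<circ> (\<lambda>z. c * z)) holomorphic_on ball 0 1"
      by (rule holomorphic_on_compose_gen[OF _ D(1)]) (use c in \<open>auto intro!: holomorphic_intros simp: norm_mult\<close>)
    have int_eq: "(\<integral>z. norm (F (c * (of_real R * z))) powr r \<partial>circle) = (\<integral>z. norm (F (of_real R * z)) powr r \<partial>circle)"
      if "R \<in> {0..<1}" for R
    proof -
      have [measurable]: "(\<lambda>z. F (of_real R * z)) \<in> borel_measurable circle"
        using that by (intro borel_measurable_circle_continuous continuous_on_sphere_dilate D) auto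
      have m: "(\<lambda>z. norm (F (of_real R * z)) powr r) \<in> borel_measurable circle"
        by measurable
      have m': "(\<lambda>z. norm (F (of_real R * (c * z))) powr r) \<in> borel_measurable circle"
        by (rule measurable_compose[OF measurable_rotate_circle[OF c] m])
      show ?thesis
        using nn_integral_circle_rotate[OF c, of "\<lambda>z. ennreal (norm (F (of_real R * z)) powr r)"] m m'
        by (simp add: integral_eq_nn_integral mult.left_commute)
    qed
    have "bdd_above ((\<lambda>R. \<integral>z. norm (F (c * (of_real R * z))) powr r \<partial>circle) ` {0..<1})"
      by (subst image_cong[OF refl int_eq]) (use D(2) in \<open>auto simp: Hr_disc_def\<close>)
    then show ?thesis
      using hol by (simp add: Hr_disc_def o_def)
  qed
  ultimately show ?thesis by (simp add: boundary_function_def)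
qed

lemma filterlim_radius: "filterlim radius (at_left 1) sequentially"
  unfolding filterlim_at using radius_tendsto radius_bounds by (auto intro!: always_eventually simp: less_imp_neq)

lemma norm_powr_le_hardy_max:
  assumes F: "boundary_function r F f" and r: "0 < r"
  shows "AE z in circle. ennreal (norm (f z) powr r) \<le> hardy_max r F z"
  using boundary_functionD(4)[OF F]
proof eventually_elim
  fix z assume "((\<lambda>R. F (of_real R * z)) \<longlongrightarrow> f z) (at_left 1)"
  then have "(\<lambda>n. F (of_real (radius n) * z)) \<longlonglongrightarrow> f z"
    by (rule filterlim_compose[OF _ filterlim_radius])
  then have "(\<lambda>n. ennreal (norm (F (of_real (radius n) * z)) powr r)) \<longlonglongrightarrow> ennreal (norm (f z) powr r)"
    by (intro tendsto_ennrealI tendsto_norm_powr r)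
  then show "ennreal (norm (f z) powr r) \<le> hardy_max r F z"
    by (rule LIMSEQ_le_const2) (use hardy_max_upper radius_bounds less_imp_le in blast)
qed

text \<open>
  The maximal function is a common integrable majorant for the boundary function and all dilates, as
  needed for dominated convergence.
\<close>

lemma hardy_max_integrable_majorant:
  assumes F: "boundary_function r F f" and r: "0 < r" "r \<le> 1"
  obtains w where "integrable circle w"
    "AE z in circle. norm (f z) powr r \<le> w z"
    "\<And>R. 0 \<le> R \<Longrightarrow> R < 1 \<Longrightarrow> AE z in circle. norm (F (of_real R * z)) powr r \<le> w z"
proof
  note D = boundary_functionD[OF F]
  have m: "hardy_max r F \<in> borel_measurable circle"
    by (rule borel_measurable_hardy_max[OF D(1) r(1)])
  have fin: "(\<integral>\<^sup>+z. hardy_max r F z \<partial>circle) \<noteq> \<infinity>"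
    using D(2) Hr_disc_iff_hardy_max_finite[OF r] by auto
  have AEfin: "AE z in circle. hardy_max r F z \<noteq> \<infinity>"
    by (rule nn_integral_PInf_AE[OF m fin])
  show "integrable circle (\<lambda>z. enn2real (hardy_max r F z))"
  proof (rule integrableI_bounded)
    have "AE z in circle. ennreal (norm (enn2real (hardy_max r F z))) = hardy_max r F z"
      using AEfin by eventually_elim (simp add: top.not_eq_extremum)
    then have "(\<integral>\<^sup>+z. ennreal (norm (enn2real (hardy_max r F z))) \<partial>circle) = (\<integral>\<^sup>+z. hardy_max r F z \<partial>circle)"
      by (rule nn_integral_cong_AE)
    then show "(\<integral>\<^sup>+z. ennreal (norm (enn2real (hardy_max r F z))) \<partial>circle) < \<infinity>"
      using fin by (simp add: top.not_eq_extremum)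
  qed (use m in measurable)
  have real: "x \<le> enn2real y" if "ennreal x \<le> y" "y \<noteq> \<infinity>" for x y
    using that by (cases y) (auto simp: ennreal_le_iff2 split: if_splits)
  show "AE z in circle. norm (f z) powr r \<le> enn2real (hardy_max r F z)"
    using AEfin norm_powr_le_hardy_max[OF F r(1)] by eventually_elim (rule real)
  show "AE z in circle. norm (F (of_real R * z)) powr r \<le> enn2real (hardy_max r F z)"
    if "0 \<le> R" "R < 1" for R
    using AEfin by eventually_elim (intro real hardy_max_upper that)
qed

lemma Lr_space_diff:
  assumes r: "0 < r" "r \<le> 1" and f: "f \<in> Lr_space r" and g: "g \<in> Lr_space r"
  shows "(\<lambda>z. f z - g z) \<in> Lr_space r"
proof -
  have [measurable]: "f \<in> borel_measurable circle" "g \<in> borel_measurable circle"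
    using f g by (auto simp: Lr_space_def)
  have "integrable circle (\<lambda>z. norm (f z - g z) powr r)"
  proof (rule Bochner_Integration.integrable_bound)
    show "integrable circle (\<lambda>z. norm (f z) powr r + norm (g z) powr r)"
      using f g by (simp add: Lr_space_def)
    show "AE z in circle. norm (norm (f z - g z) powr r) \<le> norm (norm (f z) powr r + norm (g z) powr r)"
      using norm_diff_powr_le[OF r] by (intro AE_I2) simp
  qed measurable
  then show ?thesis by (simp add: Lr_space_def)
qed

lemma Lr_dist_triangle:
  assumes r: "0 < r" "r \<le> 1" and f: "f \<in> Lr_space r" and g: "g \<in> Lr_space r" and h: "h \<in> Lr_space r"
  shows "Lr_dist r f h \<le> Lr_dist r f g + Lr_dist r g h"
proof -
  have int: "integrable circle (\<lambda>z. norm (f z - g z) powr r)" "integrable circle (\<lambda>z. norm (g z - h z) powr r)"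
    "integrable circle (\<lambda>z. norm (f z - h z) powr r)"
    using Lr_space_diff[OF r] f g h by (auto simp: Lr_space_def)
  have "Lr_dist r f h \<le> (\<integral>z. norm (f z - g z) powr r + norm (g z - h z) powr r \<partial>circle)"
    unfolding Lr_dist_def
  proof (rule integral_mono)
    show "norm (f z - h z) powr r \<le> norm (f z - g z) powr r + norm (g z - h z) powr r" for z
      using norm_add_powr_le[OF r, of "f z - g z" "g z - h z"] by simp
  qed (use int in auto)
  also have "\<dots> = Lr_dist r f g + Lr_dist r g h"
    unfolding Lr_dist_def using int by simp
  finally show ?thesis .
qed

lemma Lr_dist_commute: "Lr_dist r f g = Lr_dist r g f"
  unfolding Lr_dist_def by (simp add: norm_minus_commute)

lemma boundary_function_Lr_space:
  assumes F: "boundary_function r F f" and r: "0 < r" "r \<le> 1"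
  shows "f \<in> Lr_space r"
proof -
  note D = boundary_functionD[OF F]
  obtain w where w: "integrable circle w" "AE z in circle. norm (f z) powr r \<le> w z"
    using hardy_max_integrable_majorant[OF F r] by blast
  have "integrable circle (\<lambda>z. norm (f z) powr r)"
  proof (rule Bochner_Integration.integrable_bound[OF w(1)])
    show "(\<lambda>z. norm (f z) powr r) \<in> borel_measurable circle" using D(3) by measurable
    show "AE z in circle. norm (norm (f z) powr r) \<le> norm (w z)"
      using w(2) by eventually_elim auto
  qed
  then show ?thesis using D(3) by (simp add: Lr_space_def)
qed

lemma dilate_Lr_space:
  assumes "F holomorphic_on ball 0 1" "0 \<le> R" "R < 1" "0 < r"
  shows "(\<lambda>z. F (of_real R * z)) \<in> Lr_space r"
  using assms by (auto simp: Lr_space_def intro!: integrable_norm_powr_dilate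
      borel_measurable_circle_continuous continuous_on_sphere_dilate)

theorem dilates_tendsto_boundary_function:
  assumes F: "boundary_function r F f" and r: "0 < r" "r \<le> 1"
  shows "(\<lambda>n. Lr_dist r f (\<lambda>z. F (of_real (radius n) * z))) \<longlonglongrightarrow> 0"
proof -
  note D = boundary_functionD[OF F]
  obtain w where w: "integrable circle w" "AE z in circle. norm (f z) powr r \<le> w z"
    "\<And>R. 0 \<le> R \<Longrightarrow> R < 1 \<Longrightarrow> AE z in circle. norm (F (of_real R * z)) powr r \<le> w z"
    using hardy_max_integrable_majorant[OF F r] by blast
  have rad: "0 \<le> radius n" "radius n < 1" for n
    using radius_bounds[of n] by auto
  have m[measurable]: "(\<lambda>z. F (of_real (radius n) * z)) \<in> borel_measurable circle" for n
    by (intro borel_measurable_circle_continuous continuous_on_sphere_dilate D rad)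
  have [measurable]: "f \<in> borel_measurable circle" by (rule D)
  have "(\<lambda>n. \<integral>z. norm (f z - F (of_real (radius n) * z)) powr r \<partial>circle) \<longlonglongrightarrow> (\<integral>z. 0 \<partial>circle)"
  proof (rule integral_dominated_convergence)
    show "integrable circle (\<lambda>z. w z + w z)" using w(1) by simp
    show "AE z in circle. norm (norm (f z - F (of_real (radius n) * z)) powr r) \<le> w z + w z" for n
      using w(2) w(3)[OF rad[of n]]
    proof eventually_elim
      case (elim z)
      then show ?case
        using norm_diff_powr_le[OF r, of "f z" "F (of_real (radius n) * z)"] by simp
    qed
    show "AE z in circle. (\<lambda>n. norm (f z - F (of_real (radius n) * z)) powr r) \<longlonglongrightarrow> 0"
      using D(4)
    proof eventually_elim
      case (elim z)
      then have "(\<lambda>n. F (of_real (radius n) * z)) \<longlonglongrightarrow> f z"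
        by (rule filterlim_compose[OF _ filterlim_radius])
      then have "(\<lambda>n. f z - F (of_real (radius n) * z)) \<longlonglongrightarrow> f z - f z"
        by (intro tendsto_diff tendsto_const)
      from tendsto_norm_powr[OF this r(1)] show ?case using r by simp
    qed
  qed measurable
  then show ?thesis by (simp add: Lr_dist_def)
qed

text \<open>
  A consequence of the reverse triangle inequality for the \<open>L\<^sup>r\<close> metric.
\<close>

lemma dilate_norms_tendsto:
  assumes F: "boundary_function r F f" and r: "0 < r" "r \<le> 1"
  shows "(\<lambda>n. \<integral>z. norm (F (of_real (radius n) * z)) powr r \<partial>circle) \<longlonglongrightarrow> (\<integral>z. norm (f z) powr r \<partial>circle)"
proof -
  have rad: "0 \<le> radius n" "radius n < 1" for n
    using radius_bounds[of n] by auto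
  have 0: "(\<lambda>_. 0) \<in> Lr_space r" using r by (simp add: Lr_space_def)
  have f: "f \<in> Lr_space r" by (rule boundary_function_Lr_space[OF F r])
  have d: "(\<lambda>z. F (of_real (radius n) * z)) \<in> Lr_space r" for n
    by (intro dilate_Lr_space boundary_functionD[OF F] rad r)
  have n: "(\<integral>z. norm (g z) powr r \<partial>circle) = Lr_dist r g (\<lambda>_. 0)" for g
    by (simp add: Lr_dist_def)
  show ?thesis
    unfolding n
  proof (rule LIM_zero_cancel, rule Lim_null_comparison[OF _ dilates_tendsto_boundary_function[OF F r]], intro always_eventually allI)
    fix n
    show "norm (Lr_dist r (\<lambda>z. F (of_real (radius n) * z)) (\<lambda>_. 0) - Lr_dist r f (\<lambda>_. 0))
        \<le> Lr_dist r f (\<lambda>z. F (of_real (radius n) * z))"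
      using Lr_dist_triangle[OF r f d[of n] 0] Lr_dist_triangle[OF r d[of n] f 0]
        Lr_dist_commute[of r f "\<lambda>z. F (of_real (radius n) * z)"] by (simp add: abs_le_iff)
  qed
qed

text \<open>
  The circle means of \<open>F\<close> along \<open>radius n\<close> converge to the integral over the boundary, so the lower
  limit in \<open>nn_integral_hardy_max_liminf\<close> is known.
\<close>

theorem nn_integral_hardy_max_le_boundary:
  assumes F: "boundary_function r F f" and r: "0 < r" "r \<le> 1"
  shows "(\<integral>\<^sup>+z. hardy_max r F z \<partial>circle) \<le> ennreal (256 * (\<integral>z. norm (f z) powr r \<partial>circle))"
proof -
  have hol: "F holomorphic_on ball 0 1" by (rule boundary_functionD[OF F])
  have "(\<integral>\<^sup>+z. hardy_max r F z \<partial>circle)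
    \<le> liminf (\<lambda>n. 256 * (\<integral>\<^sup>+z. ennreal (norm (F (of_real (radius n) * z)) powr r) \<partial>circle))"
    by (rule nn_integral_hardy_max_liminf[OF hol r])
  also have "\<dots> = liminf (\<lambda>n. ennreal (256 * (\<integral>z. norm (F (of_real (radius n) * z)) powr r \<partial>circle)))"
    using radius_bounds r by (simp add: nn_integral_norm_powr_dilate[OF hol] less_imp_le ennreal_mult)
  also have "\<dots> = ennreal (256 * (\<integral>z. norm (f z) powr r \<partial>circle))"
    by (intro lim_imp_Liminf tendsto_ennrealI tendsto_mult tendsto_const dilate_norms_tendsto[OF F r]) simp
  finally show ?thesis .
qed

text \<open>
  The Poisson kernel at \<open>\<zeta>\<close> is at most \<open>2 / (1 - |\<zeta>|)\<close>; apply the sub-mean-value property to the dilates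
  and let the radius tend to \<open>1\<close>.
\<close>

theorem point_evaluation_bound:
  assumes F: "boundary_function r F f" and r: "0 < r" "r \<le> 1" and z: "norm \<zeta> < 1"
  shows "norm (F \<zeta>) powr r \<le> 2 / (1 - norm \<zeta>) * (\<integral>z. norm (f z) powr r \<partial>circle)"
proof (rule LIMSEQ_le)
  note D = boundary_functionD[OF F]
  show "(\<lambda>n. norm (F (of_real (radius n) * \<zeta>)) powr r) \<longlonglongrightarrow> norm (F \<zeta>) powr r"
    using tendsto_radial[OF D(1) radius_tendsto, of \<zeta>] z r by (intro tendsto_norm_powr) auto
  show "(\<lambda>n. 2 / (1 - norm \<zeta>) * (\<integral>z. norm (F (of_real (radius n) * z)) powr r \<partial>circle))
      \<longlonglongrightarrow> 2 / (1 - norm \<zeta>) * (\<integral>z. norm (f z) powr r \<partial>circle)"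
    by (intro tendsto_mult tendsto_const dilate_norms_tendsto[OF F r])
  have "norm (F (of_real (radius n) * \<zeta>)) powr r
      \<le> 2 / (1 - norm \<zeta>) * (\<integral>z. norm (F (of_real (radius n) * z)) powr r \<partial>circle)" for n
  proof -
    have rad: "0 < radius n" "0 \<le> radius n" "radius n < 1"
      using radius_bounds[of n] by auto
    have cont: "continuous_on (sphere 0 1) (\<lambda>w. norm (F (of_real (radius n) * w)) powr r)"
      by (intro continuous_on_norm_powr continuous_on_sphere_dilate D rad r)
    have "norm (F (of_real (radius n) * \<zeta>)) powr r
      \<le> (\<integral>w. poisson \<zeta> w * norm (F (of_real (radius n) * w)) powr r \<partial>circle)"
      by (rule norm_powr_le_poisson[OF holomorphic_dilate[OF D(1) rad(1)] _ z r]) (use rad in simp)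
    also have "\<dots> \<le> (\<integral>w. 2 / (1 - norm \<zeta>) * norm (F (of_real (radius n) * w)) powr r \<partial>circle)"
      by (intro integral_mono integrable_circle_continuous continuous_on_mult continuous_on_const
          continuous_on_poisson z cont mult_right_mono poisson_le) auto
    finally show ?thesis by simp
  qed
  then show "\<exists>N. \<forall>n\<ge>N. norm (F (of_real (radius n) * \<zeta>)) powr r
      \<le> 2 / (1 - norm \<zeta>) * (\<integral>z. norm (F (of_real (radius n) * z)) powr r \<partial>circle)" by blast
qed

section \<open>Closedness, polynomial approximation and the decomposition\<close>

lemma Lr_dist_nonneg: "0 \<le> Lr_dist r f g"
  unfolding Lr_dist_def by (intro Bochner_Integration.integral_nonneg) auto

text \<open>
  Point evaluations are bounded uniformly on smaller discs, so \<open>L\<^sup>r\<close> closeness on the circle forces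
  uniform closeness inside.
\<close>

lemma uniformly_convergent_of_Lr_Cauchy:
  assumes G: "\<And>n. boundary_function r (G n) (g n)" and r: "0 < r" "r \<le> 1"
    and d: "\<And>m n. Lr_dist r (g m) (g n) \<le> e m + e n" and e: "e \<longlonglongrightarrow> 0" and \<rho>: "\<rho> < 1"
  shows "uniformly_convergent_on (cball 0 \<rho>) G"
proof (rule Cauchy_uniformly_convergent, rule uniformly_Cauchy_onI)
  fix \<epsilon> :: real assume \<epsilon>: "\<epsilon> > 0"
  \<comment> \<open>The factor compensates \<open>2 / (1 - \<rho>)\<close> and the sum of two error terms.\<close>
  define \<eta> where "\<eta> = \<epsilon> powr r * (1 - \<rho>) / 4"
  have \<eta>: "\<eta> > 0" unfolding \<eta>_def using \<epsilon> \<rho> by simp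
  obtain M where M: "\<And>n. n \<ge> M \<Longrightarrow> e n < \<eta>"
    using order_tendstoD(2)[OF e \<eta>] unfolding eventually_sequentially by blast
  have "dist (G m x) (G n x) < \<epsilon>" if x: "x \<in> cball 0 \<rho>" and mn: "m \<ge> M" "n \<ge> M" for x m n
  proof -
    have x': "norm x \<le> \<rho>" "norm x < 1" using x \<rho> by auto
    have "norm (G m x - G n x) powr r \<le> 2 / (1 - norm x) * Lr_dist r (g m) (g n)"
      unfolding Lr_dist_def
      by (rule point_evaluation_bound[OF boundary_function_diff[OF r G G] r x'(2)])
    also have "\<dots> \<le> 2 / (1 - \<rho>) * (e m + e n)"
      using x' \<rho> d Lr_dist_nonneg by (intro mult_mono divide_left_mono) auto
    also have "\<dots> < 2 / (1 - \<rho>) * (\<eta> + \<eta>)"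
      using M[OF mn(1)] M[OF mn(2)] \<rho> by (intro mult_strict_left_mono add_strict_mono) auto
    also have "\<dots> = \<epsilon> powr r"
      using \<rho> by (simp add: \<eta>_def field_simps)
    finally have lt: "norm (G m x - G n x) powr r < \<epsilon> powr r" .
    show ?thesis
    proof (rule ccontr)
      assume "\<not> ?thesis"
      then have "\<epsilon> powr r \<le> norm (G m x - G n x) powr r"
        using \<epsilon> r by (intro powr_mono2) (auto simp: dist_norm)
      with lt show False by simp
    qed
  qed
  then show "\<exists>M. \<forall>x\<in>cball 0 \<rho>. \<forall>m\<ge>M. \<forall>n\<ge>M. dist (G m x) (G n x) < \<epsilon>" by blast
qed

lemma tendsto_radial_limit_interchange:
  fixes F :: "complex \<Rightarrow> complex" and G :: "nat \<Rightarrow> complex \<Rightarrow> complex"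
  assumes lim: "\<And>n. ((\<lambda>R. G n (of_real R * z)) \<longlongrightarrow> g n) (at_left 1)"
    and near: "\<And>e. e > 0 \<Longrightarrow> \<exists>n. norm (y - g n) < e \<and> (\<forall>R. 0 \<le> R \<longrightarrow> R < 1 \<longrightarrow> norm (F (of_real R * z) - G n (of_real R * z)) < e)"
  shows "((\<lambda>R. F (of_real R * z)) \<longlongrightarrow> y) (at_left 1)"
proof (rule tendstoI)
  fix e :: real assume "e > 0"
  then have e3: "e / 3 > 0" by simp
  then obtain n where n: "norm (y - g n) < e / 3"
    "\<And>R. 0 \<le> R \<Longrightarrow> R < 1 \<Longrightarrow> norm (F (of_real R * z) - G n (of_real R * z)) < e / 3"
    using near by blast
  show "\<forall>\<^sub>F R in at_left 1. dist (F (of_real R * z)) y < e"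
    using tendstoD[OF lim[of n] e3] eventually_at_left_real[OF zero_less_one]
  proof eventually_elim
    case (elim R)
    then have "norm (F (of_real R * z) - G n (of_real R * z)) < e / 3"
      "norm (G n (of_real R * z) - g n) < e / 3"
      using n(2)[of R] by (auto simp: dist_norm)
    moreover have "norm (F (of_real R * z) - y) \<le> norm (F (of_real R * z) - G n (of_real R * z)) +
        norm (G n (of_real R * z) - g n) + norm (y - g n)"
      using norm_triangle_ineq[of "F (of_real R * z) - G n (of_real R * z)" "G n (of_real R * z) - g n"]
        norm_triangle_ineq4[of "F (of_real R * z) - g n" "y - g n"] by simp
    ultimately show ?case using n(1) unfolding dist_norm by linarith
  qed
qed

text \<open>
  If \<open>g n\<close> tends to \<open>f\<close> in \<open>L\<^sup>r\<close>, the extensions \<open>G n\<close> converge locally uniformly to some \<open>F\<close>. The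
  maximal inequality for \<open>G m - G n\<close> survives the limit in \<open>m\<close> and shows that \<open>F - G n\<close> has a small
  maximal function. For almost every point of the circle, some \<open>G n\<close> is therefore close to \<open>F\<close> on the
  entire radius while \<open>g n\<close> is close to \<open>f\<close> at its end, so the radial limit of \<open>F\<close> is \<open>f\<close>.
\<close>

theorem Hr_circle_closed:
  assumes r: "0 < r" "r \<le> 1" and f: "f \<in> Lr_closure r (Hr_circle r)"
  shows "f \<in> Hr_circle r"
proof -
  have fL: "f \<in> Lr_space r" using f by (simp add: Lr_closure_def)
  then have [measurable]: "f \<in> borel_measurable circle" by (simp add: Lr_space_def)
  define e where "e n = inverse (real (Suc n))" for n
  have e0: "e n > 0" for n by (simp add: e_def)
  have elim: "e \<longlonglongrightarrow> 0" unfolding e_def by (rule LIMSEQ_inverse_real_of_nat)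
  have "\<exists>h G. boundary_function r G h \<and> Lr_dist r f h < e n" for n
  proof -
    have "\<forall>\<epsilon>>0. \<exists>h\<in>Hr_circle r. Lr_dist r f h < \<epsilon>"
      using f by (simp add: Lr_closure_def)
    then obtain h where "h \<in> Hr_circle r" "Lr_dist r f h < e n"
      using e0[of n] by blast
    then show ?thesis unfolding Hr_circle_iff by blast
  qed
  then obtain g G where G: "\<And>n. boundary_function r (G n) (g n)" and fg: "\<And>n. Lr_dist r f (g n) < e n"
    by metis
  have gL: "g n \<in> Lr_space r" for n by (rule boundary_function_Lr_space[OF G r])
  then have [measurable]: "g n \<in> borel_measurable circle" for n by (simp add: Lr_space_def)
  have holG: "G n holomorphic_on ball 0 1" for n by (rule boundary_functionD[OF G])
  have gg: "Lr_dist r (g m) (g n) \<le> e m + e n" for m n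
    using Lr_dist_triangle[OF r gL[of m] fL gL[of n]] fg[of m] fg[of n] Lr_dist_commute[of r "g m" f]
    by simp
  define F where "F z = lim (\<lambda>n. G n z)" for z
  have unif: "uniform_limit (cball 0 \<rho>) G F sequentially" if "\<rho> < 1" for \<rho>
    using uniformly_convergent_of_Lr_Cauchy[OF G r gg elim that]
    by (simp add: uniformly_convergent_uniform_limit_iff F_def[abs_def])
  have ptlim: "(\<lambda>n. G n z) \<longlonglongrightarrow> F z" if "norm z < 1" for z
    by (rule tendsto_uniform_limitI[OF unif[OF that]]) simp
  have holF: "F holomorphic_on ball 0 1"
  proof (rule holomorphic_uniform_sequence[OF open_ball holG])
    fix x :: complex assume x: "x \<in> ball 0 1"
    define d where "d = (1 - norm x) / 2"
    have d: "0 < d" "norm x + d < 1" using x by (auto simp: d_def field_simps)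
    have sub: "cball x d \<subseteq> cball 0 (norm x + d)"
    proof
      fix y assume "y \<in> cball x d"
      then show "y \<in> cball 0 (norm x + d)"
        using norm_triangle_ineq2[of y x] by (simp add: dist_norm norm_minus_commute)
    qed
    then have "cball x d \<subseteq> ball 0 1" using d by (auto simp: subset_iff)
    with d show "\<exists>d>0. cball x d \<subseteq> ball 0 1 \<and> uniform_limit (cball x d) G F sequentially"
      using uniform_limit_on_subset[OF unif[OF d(2)] sub] by blast
  qed
  have holFG: "(\<lambda>z. F z - G n z) holomorphic_on ball 0 1" for n
    by (intro holomorphic_intros holF holG)
  have max_diff: "(\<integral>\<^sup>+z. hardy_max r (\<lambda>z. F z - G n z) z \<partial>circle) \<le> ennreal (512 * e n)" for n
  proof -
    have "(\<integral>\<^sup>+z. hardy_max r (\<lambda>z. F z - G n z) z \<partial>circle)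
        \<le> (\<integral>\<^sup>+z. liminf (\<lambda>m. hardy_max r (\<lambda>z. G m z - G n z) z) \<partial>circle)"
    proof (rule nn_integral_mono)
      fix z assume "z \<in> space circle"
      then have z: "norm z = 1" by simp
      show "hardy_max r (\<lambda>z. F z - G n z) z \<le> liminf (\<lambda>m. hardy_max r (\<lambda>z. G m z - G n z) z)"
        unfolding hardy_max_def[of r "\<lambda>z. F z - G n z"]
      proof (rule SUP_least)
        fix a :: real assume a: "a \<in> {0..<1}"
        let ?x = "of_real a * z"
        have "(\<lambda>m. ennreal (norm (G m ?x - G n ?x) powr r)) \<longlonglongrightarrow> ennreal (norm (F ?x - G n ?x) powr r)"
          by (intro tendsto_ennrealI tendsto_norm_powr r tendsto_diff tendsto_const ptlim)
            (use a z in \<open>simp add: norm_mult\<close>)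
        then have "ennreal (norm (F ?x - G n ?x) powr r) = liminf (\<lambda>m. ennreal (norm (G m ?x - G n ?x) powr r))"
          by (rule lim_imp_Liminf[OF trivial_limit_sequentially, symmetric])
        also have "\<dots> \<le> liminf (\<lambda>m. hardy_max r (\<lambda>z. G m z - G n z) z)"
          using a by (intro Liminf_mono always_eventually allI hardy_max_upper) auto
        finally show "ennreal (norm (F ?x - G n ?x) powr r) \<le> \<dots>" .
      qed
    qed
    also have "\<dots> \<le> liminf (\<lambda>m. \<integral>\<^sup>+z. hardy_max r (\<lambda>z. G m z - G n z) z \<partial>circle)"
      by (intro nn_integral_liminf borel_measurable_hardy_max holomorphic_intros holG r)
    also have "\<dots> \<le> ennreal (512 * e n)"
    proof (rule liminf_le_const)
      show "\<forall>\<^sub>F m in sequentially. (\<integral>\<^sup>+z. hardy_max r (\<lambda>z. G m z - G n z) z \<partial>circle) \<le> ennreal (512 * e n)"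
        using eventually_ge_at_top[of n]
      proof eventually_elim
        case (elim m)
        then have "e m \<le> e n" by (simp add: e_def inverse_eq_divide frac_le)
        have "(\<integral>\<^sup>+z. hardy_max r (\<lambda>z. G m z - G n z) z \<partial>circle) \<le> ennreal (256 * Lr_dist r (g m) (g n))"
          unfolding Lr_dist_def by (rule nn_integral_hardy_max_le_boundary[OF boundary_function_diff[OF r G G] r])
        also have "\<dots> \<le> ennreal (512 * e n)"
          using gg[of m n] \<open>e m \<le> e n\<close> by (intro ennreal_leI) simp
        finally show ?case .
      qed
    qed
    finally show ?thesis .
  qed
  \<comment> \<open>Any fixed index serves here: \<open>F\<close> is a sum of two members of the space.\<close>
  have FG_disc: "(\<lambda>z. F z - G 0 z) \<in> Hr_disc r"
    using max_diff[of 0] holFG[of 0] by (auto simp: Hr_disc_iff_hardy_max_finite[OF r] intro: le_less_trans)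
  have F_disc: "F \<in> Hr_disc r"
    using Hr_disc_add[OF r FG_disc boundary_functionD(2)[OF G[of 0]]] by simp
  \<comment> \<open>Powers of the distance from \<open>F\<close> to \<open>G n\<close> along the whole radius and of the distance from \<open>f\<close> to \<open>g n\<close> at its end.\<close>
  define h where "h n z = hardy_max r (\<lambda>z. F z - G n z) z + ennreal (norm (f z - g n z) powr r)" for n z
  have hm1[measurable]: "hardy_max r (\<lambda>z. F z - G n z) \<in> borel_measurable circle" for n
    by (rule borel_measurable_hardy_max[OF holFG r(1)])
  have hm[measurable]: "h n \<in> borel_measurable circle" for n
    unfolding h_def by measurable
  have h_int: "(\<integral>\<^sup>+z. h n z \<partial>circle) \<le> ennreal (513 * e n)" for n
  proof -
    have "integrable circle (\<lambda>z. norm (f z - g n z) powr r)"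
      using Lr_space_diff[OF r fL gL] by (simp add: Lr_space_def)
    then have "(\<integral>\<^sup>+z. ennreal (norm (f z - g n z) powr r) \<partial>circle) = ennreal (Lr_dist r f (g n))"
      unfolding Lr_dist_def by (intro nn_integral_eq_integral) auto
    also have "\<dots> \<le> ennreal (e n)" using fg[of n] by (intro ennreal_leI) simp
    finally have "(\<integral>\<^sup>+z. h n z \<partial>circle) \<le> ennreal (512 * e n) + ennreal (e n)"
      unfolding h_def by (subst nn_integral_add) (auto intro!: add_mono max_diff)
    also have "\<dots> = ennreal (513 * e n)"
      using e0[of n] by (simp flip: ennreal_plus)
    finally show ?thesis .
  qed
  \<comment> \<open>A lower limit suffices: one good index per point and tolerance is enough.\<close>
  have "(\<integral>\<^sup>+z. liminf (\<lambda>n. h n z) \<partial>circle) \<le> liminf (\<lambda>n. \<integral>\<^sup>+z. h n z \<partial>circle)"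
    by (rule nn_integral_liminf) measurable
  also have "\<dots> \<le> liminf (\<lambda>n. ennreal (513 * e n))"
    by (intro Liminf_mono always_eventually allI h_int)
  also have "\<dots> = ennreal (513 * 0)"
    by (intro lim_imp_Liminf tendsto_ennrealI tendsto_mult tendsto_const elim) simp
  finally have "(\<integral>\<^sup>+z. liminf (\<lambda>n. h n z) \<partial>circle) = 0" by simp
  then have "AE z in circle. liminf (\<lambda>n. h n z) = 0"
    by (subst (asm) nn_integral_0_iff_AE) measurable
  moreover have "AE z in circle. \<forall>n. ((\<lambda>R. G n (of_real R * z)) \<longlongrightarrow> g n z) (at_left 1)"
    unfolding AE_all_countable using boundary_functionD(4)[OF G] by blast
  ultimately have "AE z in circle. ((\<lambda>R. F (of_real R * z)) \<longlongrightarrow> f z) (at_left 1)"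
  proof eventually_elim
    case (elim z)
    show ?case
    proof (rule tendsto_radial_limit_interchange)
      show "((\<lambda>R. G n (of_real R * z)) \<longlongrightarrow> g n z) (at_left 1)" for n using elim(2) by blast
      fix \<epsilon> :: real assume \<epsilon>: "\<epsilon> > 0"
      have "\<exists>n. h n z < ennreal (\<epsilon> powr r)"
      proof (rule ccontr)
        assume "\<not> ?thesis"
        then have "ennreal (\<epsilon> powr r) \<le> liminf (\<lambda>n. h n z)"
          by (intro Liminf_bounded always_eventually) (auto simp: not_less)
        then show False using elim(1) \<epsilon> by simp
      qed
      then obtain n where n: "h n z < ennreal (\<epsilon> powr r)" by blast
      have small: "norm x < \<epsilon>" if "ennreal (norm x powr r) \<le> h n z" for x :: complex
      proof (rule ccontr)
        assume "\<not> norm x < \<epsilon>"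
        then have "ennreal (\<epsilon> powr r) \<le> ennreal (norm x powr r)"
          using \<epsilon> r by (intro ennreal_leI powr_mono2) auto
        from leD[OF order_trans[OF this that]] n show False by blast
      qed
      have "norm (f z - g n z) < \<epsilon>" by (rule small) (simp add: h_def)
      moreover have "norm (F (of_real R * z) - G n (of_real R * z)) < \<epsilon>" if "0 \<le> R" "R < 1" for R
        by (rule small) (use hardy_max_upper[OF that, of "\<lambda>z. F z - G n z" z r] in \<open>auto simp: h_def intro: order_trans\<close>)
      ultimately show "\<exists>n. norm (f z - g n z) < \<epsilon> \<and>
          (\<forall>R. 0 \<le> R \<longrightarrow> R < 1 \<longrightarrow> norm (F (of_real R * z) - G n (of_real R * z)) < \<epsilon>)" by blast
    qed
  qed
  then have "boundary_function r F f"
    unfolding boundary_function_def using F_disc by simp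
  then show ?thesis by (auto simp: Hr_circle_iff)
qed

text \<open>
  First a dilate of \<open>F\<close>, then a Taylor polynomial of the dilate; neither step changes the value at
  the origin.
\<close>

lemma Hr_circle_polynomial_dense:
  assumes F: "boundary_function r F f" and r: "0 < r" "r \<le> 1" and \<epsilon>: "\<epsilon> > 0"
  obtains p where "Lr_dist r f (poly p) < \<epsilon>" "poly p 0 = F 0"
proof -
  have hol: "F holomorphic_on ball 0 1" by (rule boundary_functionD[OF F])
  have "\<epsilon> / 2 > 0" using \<epsilon> by simp
  then obtain n where n: "Lr_dist r f (\<lambda>z. F (of_real (radius n) * z)) < \<epsilon> / 2"
    using order_tendstoD(2)[OF dilates_tendsto_boundary_function[OF F r]] unfolding eventually_sequentially
    by blast
  define G where "G z = F (of_real (radius n) * z)" for z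
  have rad: "0 < radius n" "0 \<le> radius n" "radius n < 1" using radius_bounds[of n] by auto
  have holG: "G holomorphic_on ball 0 (1 / radius n)"
    unfolding G_def by (rule holomorphic_dilate[OF hol rad(1)])
  obtain p where p: "uniform_limit (cball 0 1) (\<lambda>k. poly (p k)) G sequentially" "\<And>k. poly (p k) 0 = G 0"
    using holomorphic_uniform_limit_polys[OF holG] rad by auto
  define \<eta> where "\<eta> = (\<epsilon> / 2) powr (1 / r)"
  have \<eta>: "\<eta> > 0" "\<eta> powr r = \<epsilon> / 2" using \<epsilon> r by (auto simp: \<eta>_def powr_powr)
  obtain k where k: "\<And>w. w \<in> cball 0 1 \<Longrightarrow> dist (poly (p k) w) (G w) < \<eta>"
    using uniform_limitD[OF p(1) \<eta>(1)] unfolding eventually_sequentially by (metis order_refl)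
  have GL: "G \<in> Lr_space r" unfolding G_def by (intro dilate_Lr_space hol rad r)
  have pL: "poly q \<in> Lr_space r" for q :: "complex poly"
    by (rule boundary_function_Lr_space[OF boundary_function_continuous r])
      (auto intro!: r holomorphic_intros continuous_intros)
  have "Lr_dist r G (poly (p k)) \<le> (\<integral>z. \<epsilon> / 2 \<partial>circle)"
    unfolding Lr_dist_def
  proof (rule integral_mono)
    show "integrable circle (\<lambda>z. norm (G z - poly (p k) z) powr r)"
      using Lr_space_diff[OF r GL pL] by (simp add: Lr_space_def)
    fix z assume "z \<in> space circle"
    then have "norm (G z - poly (p k) z) \<le> \<eta>"
      using k[of z] by (simp add: dist_norm norm_minus_commute)
    then show "norm (G z - poly (p k) z) powr r \<le> \<epsilon> / 2"
      using powr_mono2[of r "norm (G z - poly (p k) z)" \<eta>] r \<eta> by simp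
  qed simp
  then have "Lr_dist r G (poly (p k)) \<le> \<epsilon> / 2" by (simp add: measure_circle)
  then have "Lr_dist r f (poly (p k)) < \<epsilon>"
    using Lr_dist_triangle[OF r boundary_function_Lr_space[OF F r] GL pL[of "p k"]] n
    unfolding G_def by simp
  moreover have "poly (p k) 0 = F 0" using p(2)[of k] by (simp add: G_def)
  ultimately show thesis by (rule that)
qed

lemma rot_op_eq: "rot_op \<alpha> f = (\<lambda>z. f (cis (2 * pi * \<alpha>) * z))"
  by (auto simp: rot_op_def rotation_def)

lemma irrational_rotation_power_neq_1:
  assumes "\<alpha> \<notin> \<rat>" "k > 0"
  shows "cis (2 * pi * \<alpha>) ^ k \<noteq> 1"
proof
  assume "cis (2 * pi * \<alpha>) ^ k = 1"
  then have "cis (real k * (2 * pi * \<alpha>)) = 1"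
    by (simp only: Complex.DeMoivre)
  then have "cos (real k * (2 * pi * \<alpha>)) = 1"
    by (simp only: complex_eq_iff cis.sel one_complex.sel)
  then obtain n :: int where "real k * (2 * pi * \<alpha>) = of_int n * 2 * pi"
    using cos_one_2pi_int by blast
  then have "real k * \<alpha> = of_int n" by simp
  then have "\<alpha> = of_int n / of_nat k" using assms(2) by (simp add: field_simps)
  also have "\<dots> \<in> \<rat>" by (intro Rats_divide Rats_of_int Rats_of_nat)
  finally show False using assms(1) by simp
qed

text \<open>
  Comparing coefficients: \<open>z\<^sup>k\<close> is an eigenfunction of the rotation operator with eigenvalue \<open>\<omega>\<^sup>k\<close>, which
  differs from \<open>1\<close> for \<open>k > 0\<close>.
\<close>

lemma polynomial_cohomological_equation:
  assumes "\<alpha> \<notin> \<rat>"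
  obtains q where "\<And>z. poly q z - rot_op \<alpha> (poly q) z = poly p z - poly p 0"
proof -
  define \<omega> where "\<omega> = cis (2 * pi * \<alpha>)"
  \<comment> \<open>The constant coefficient is free, as the rotation fixes constants; it is taken to be \<open>0\<close>.\<close>
  define c where "c k = (if k = 0 then 0 else coeff p k / (1 - \<omega> ^ k))" for k
  define q where "q = (\<Sum>k\<le>degree p. monom (c k) k)"
  have "poly q z - poly q (\<omega> * z) = poly p z - poly p 0" for z
  proof -
    have "poly q z - poly q (\<omega> * z) = (\<Sum>k\<le>degree p. c k * (1 - \<omega> ^ k) * z ^ k)"
      unfolding q_def by (simp add: poly_sum poly_monom power_mult_distrib sum_subtractf[symmetric] algebra_simps)
    also have "\<dots> = (\<Sum>k\<le>degree p. (if k = 0 then 0 else coeff p k * z ^ k))"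
      using irrational_rotation_power_neq_1[OF assms] by (intro sum.cong) (auto simp: c_def \<omega>_def)
    also have "\<dots> = (\<Sum>k\<le>degree p. coeff p k * z ^ k - (if k = 0 then coeff p 0 else 0))"
      by (intro sum.cong) auto
    also have "\<dots> = poly p z - coeff p 0"
      by (simp add: sum_subtractf poly_altdef)
    finally show ?thesis by (simp add: poly_0_coeff_0)
  qed
  then show thesis using that[of q] by (simp add: rot_op_eq \<omega>_def)
qed

text \<open>
  The extension \<open>H(z) - H(\<omega> z)\<close> vanishes at the origin, which the rotation fixes.
\<close>

lemma boundary_function_I_minus_T:
  assumes r: "0 < r" "r \<le> 1" and g: "g \<in> I_minus_T_image \<alpha> (Hr_circle r)"
  obtains G where "boundary_function r G g" "G 0 = 0"
proof -
  from g obtain h where g': "g \<in> borel_measurable circle" "h \<in> Hr_circle r"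
    "AE z in circle. g z = h z - rot_op \<alpha> h z"
    unfolding I_minus_T_image_def by blast
  then obtain H where H: "boundary_function r H h" unfolding Hr_circle_iff by blast
  have "boundary_function r (\<lambda>z. H z - H (cis (2 * pi * \<alpha>) * z)) (\<lambda>z. h z - h (cis (2 * pi * \<alpha>) * z))"
    by (intro boundary_function_diff boundary_function_rotate H r) simp
  then have "boundary_function r (\<lambda>z. H z - H (cis (2 * pi * \<alpha>) * z)) g"
    by (rule boundary_function_cong_AE) (use g' in \<open>auto simp: rot_op_eq\<close>)
  then show thesis by (rule that) simp
qed

lemma boundary_function_const:
  "0 < r \<Longrightarrow> boundary_function r (\<lambda>_. c) (\<lambda>_. c)"
  by (rule boundary_function_continuous) (auto intro!: continuous_intros)

text \<open>
  A constant \<open>c\<close> close to a \<open>g\<close> whose extension vanishes at \<open>0\<close> is small, by continuity of the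
  evaluation at \<open>0\<close>.
\<close>

lemma constants_inter_closure:
  assumes r: "0 < r" "r \<le> 1" and f: "f \<in> constants" "f \<in> Lr_closure r (I_minus_T_image \<alpha> (Hr_circle r))"
  shows "AE z in circle. f z = 0"
proof -
  from f(1) obtain c where fm: "f \<in> borel_measurable circle" and c: "AE z in circle. f z = c"
    unfolding constants_def by blast
  have Ff: "boundary_function r (\<lambda>_. c) f"
    by (rule boundary_function_cong_AE[OF boundary_function_const[OF r(1)] fm c])
  have "norm c powr r \<le> 0"
  proof (rule field_le_epsilon)
    fix e :: real assume "e > 0"
    then obtain g where g: "g \<in> I_minus_T_image \<alpha> (Hr_circle r)" "Lr_dist r f g < e / 2"
      using f(2) unfolding Lr_closure_def by (auto dest!: spec[of _ "e / 2"])
    obtain G where G: "boundary_function r G g" "G 0 = 0"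
      using boundary_function_I_minus_T[OF r g(1)] by blast
    have "norm (c - G 0) powr r \<le> 2 / (1 - norm (0::complex)) * Lr_dist r f g"
      unfolding Lr_dist_def by (rule point_evaluation_bound[OF boundary_function_diff[OF r Ff G(1)] r]) simp
    then show "norm c powr r \<le> 0 + e" using G(2) g(2) by simp
  qed
  then have "c = 0" by simp
  with c show ?thesis by simp
qed

lemma minus_mean_in_closure:
  assumes r: "0 < r" "r \<le> 1" and \<alpha>: "\<alpha> \<notin> \<rat>" and F: "boundary_function r F f"
  shows "(\<lambda>z. f z - F 0) \<in> Lr_closure r (I_minus_T_image \<alpha> (Hr_circle r))"
  unfolding Lr_closure_def
proof (intro CollectI conjI allI impI)
  show "(\<lambda>z. f z - F 0) \<in> Lr_space r"
    by (rule boundary_function_Lr_space[OF boundary_function_diff[OF r F boundary_function_const[OF r(1)]] r])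
  fix \<epsilon> :: real assume "\<epsilon> > 0"
  then obtain p where p: "Lr_dist r f (poly p) < \<epsilon>" "poly p 0 = F 0"
    using Hr_circle_polynomial_dense[OF F r] by blast
  obtain q where q: "\<And>z. poly q z - rot_op \<alpha> (poly q) z = poly p z - poly p 0"
    using polynomial_cohomological_equation[OF \<alpha>] by blast
  have "boundary_function r (poly q) (poly q)"
    by (rule boundary_function_continuous) (auto intro!: r holomorphic_intros continuous_intros)
  then have "poly q \<in> Hr_circle r" unfolding Hr_circle_iff by blast
  moreover have "(\<lambda>z. poly p z - poly p 0) \<in> borel_measurable circle"
    by (intro borel_measurable_circle_continuous continuous_intros)
  ultimately have "(\<lambda>z. poly p z - poly p 0) \<in> I_minus_T_image \<alpha> (Hr_circle r)"
    unfolding I_minus_T_image_def using q by (auto intro!: bexI[of _ "poly q"])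
  moreover have "Lr_dist r (\<lambda>z. f z - F 0) (\<lambda>z. poly p z - poly p 0) < \<epsilon>"
    using p by (simp add: Lr_dist_def)
  ultimately show "\<exists>g\<in>I_minus_T_image \<alpha> (Hr_circle r). Lr_dist r (\<lambda>z. f z - F 0) g < \<epsilon>" by blast
qed

theorem theorem3p1:
  fixes r \<alpha> :: real
  assumes "0 < r" and "r < 1" and "\<alpha> \<notin> \<rat>"
  shows "is_direct_sum (Hr_circle r) constants
           (Lr_closure r (I_minus_T_image \<alpha> (Hr_circle r)))"
  unfolding is_direct_sum_def
proof (intro conjI set_eqI iffI)
  let ?K = "Lr_closure r (I_minus_T_image \<alpha> (Hr_circle r))"
  have r: "0 < r" "r \<le> 1" using assms by auto
  fix f :: "complex \<Rightarrow> complex"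
  {
    assume "f \<in> Hr_circle r"
    then obtain F where F: "boundary_function r F f" unfolding Hr_circle_iff by blast
    have "(\<lambda>_. F 0) \<in> constants" unfolding constants_def by auto
    moreover have "(\<lambda>z. f z - F 0) \<in> ?K" by (rule minus_mean_in_closure[OF r assms(3) F])
    moreover have "AE z in circle. f z = F 0 + (f z - F 0)" by simp
    ultimately show "f \<in> {f \<in> borel_measurable circle. \<exists>a\<in>constants. \<exists>b\<in>?K. AE z in circle. f z = a z + b z}"
      using boundary_functionD(3)[OF F] by fast
  next
    assume "f \<in> {f \<in> borel_measurable circle. \<exists>a\<in>constants. \<exists>b\<in>?K. AE z in circle. f z = a z + b z}"
    then obtain a b where fm: "f \<in> borel_measurable circle" and a: "a \<in> constants" and b: "b \<in> ?K"
      and fab: "AE z in circle. f z = a z + b z" by blast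
    obtain c where c: "AE z in circle. a z = c" using a unfolding constants_def by blast
    have "I_minus_T_image \<alpha> (Hr_circle r) \<subseteq> Hr_circle r"
      using boundary_function_I_minus_T[OF r] unfolding Hr_circle_iff subset_iff by metis
    then have "b \<in> Lr_closure r (Hr_circle r)"
      using b unfolding Lr_closure_def by blast
    then obtain B where B: "boundary_function r B b"
      using Hr_circle_closed[OF r] unfolding Hr_circle_iff by blast
    have "boundary_function r (\<lambda>z. c + B z) (\<lambda>z. c + b z)"
      by (rule boundary_function_add[OF r boundary_function_const[OF r(1)] B])
    moreover have "AE z in circle. f z = c + b z"
      using fab c by eventually_elim simp
    ultimately show "f \<in> Hr_circle r"
      using boundary_function_cong_AE[OF _ fm] unfolding Hr_circle_iff by blast
  next
    assume "f \<in> constants \<inter> ?K"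
    then have f: "f \<in> constants" "f \<in> ?K" by auto
    then show "f \<in> {f \<in> borel_measurable circle. AE z in circle. f z = 0}"
      using constants_inter_closure[OF r f] by (simp add: constants_def)
  next
    assume "f \<in> {f \<in> borel_measurable circle. AE z in circle. f z = 0}"
    then have fm: "f \<in> borel_measurable circle" and f0: "AE z in circle. f z = 0" by auto
    have "boundary_function r (\<lambda>_. 0) f"
      by (rule boundary_function_cong_AE[OF boundary_function_const[OF r(1)] fm f0])
    from minus_mean_in_closure[OF r assms(3) this] have "f \<in> ?K" by simp
    then show "f \<in> constants \<inter> ?K" using fm f0 by (auto simp: constants_def)
  }
qed

end
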